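(* Let $M$ be a completable $m\times n$ partial matrix with positive specified entries, subordinate to a pattern $S\subseteq[m]\times[n]$. Let $\overline M$ be the (up to row and column permutations) block-diagonal partial matrix obtained by completing $M$ with the cycle-completion formula given in the context. Let $s$ be the number of blocks in $\overline M$, and let $b_i$ be the sum of the weights (entries) in the $i$-th block. (1) If $\sum_i\sqrt{b_i}=1$, then there is a unique completion of $M$. (2) If $\sum_i\sqrt{b_i}<1$, $s=2$ and one component is an isolated vertex, then there is a unique completion of $M$. (3) If $\sum_i\sqrt{b_i}<1$, $s=2$ and both components contain edges, then there are (exactly) two completions of $M$. (4) If $\sum_i\sqrt{b_i}<1$ and $s>2$, then the set of completions of $M$ is an $(s-2)$-dimensional basic semialgebraic set.
   Context: $[m]=\{1,\dots,m\}$. A partial matrix subordinate to a pattern $S\subseteq[m]\times[n]$ is an $m\times n$ matrix in which exactly the entries in positions $S$ are specified. $\Delta^{mn-1}$ is the standard simplex of real $m\times n$ matrices with nonnegative entries summing to one. A completion of $M$ is a rank-one matrix in $\Delta^{mn-1}$ agreeing with $M$ on $S$; $M$ is completable if it has a completion. $G(S)$ is the bipartite graph with one vertex for each row and one for each column, and an edge $(i,j)$ joining row $i$ and column $j$ for each $(i,j)\in S$. The blocks of $\overline M$ correspond to the connected components of $G(S)$; an isolated vertex (a row or column without specified entries) counts as a component, with block sum $0$. Cycle-completion formula: for $(i,j)\notin S$ with row $i$ and column $j$ in the same connected component of $G(S)$, choose a cycle $\{(r_1,c_1),(r_1,c_2),(r_2,c_2),\dots,(r_k,c_k),(r_k,c_1)\}$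 in $G(S\cup\{(i,j)\})$ ($k\ge 2$, distinct rows $r_1,\dots,r_k$, distinct columns $c_1,\dots,c_k$) with $(r_1,c_1)=(i,j)$ and set $m_{ij}=\dfrac{m_{r_1c_2}m_{r_2c_3}\cdots m_{r_kc_1}}{m_{r_2c_2}m_{r_3c_3}\cdots m_{r_kc_k}}$. (For completable positive $M$ this does not depend on the choice of cycle.) After this, all entries whose row and column lie in the same component are specified. A basic semialgebraic set is a set defined by finitely many simultaneous polynomial equations and inequalities. *)

theory Defs
  imports "HOL-Analysis.Analysis"
begin

section \<open>Partial matrices and completions\<close>

text \<open>An \<open>m \<times> n\<close> partial matrix with row indices \<open>'m\<close> and column indices \<open>'n\<close> is a
  partial function on positions; the pattern it is subordinate to is its domain.\<close>

type_synonym ('n, 'm) partial_matrix = "'m \<times> 'n \<rightharpoonup> real"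

definition matrix_simplex :: "(real^'n^'m) set" where
  "matrix_simplex = {X. (\<forall>i j. 0 \<le> X $ i $ j) \<and> (\<Sum>i\<in>UNIV. \<Sum>j\<in>UNIV. X $ i $ j) = 1}"

definition completions :: "('n::finite, 'm::finite) partial_matrix \<Rightarrow> (real^'n^'m) set" where
  "completions M = {X \<in> matrix_simplex. rank X = 1 \<and> (\<forall>(i, j) \<in> dom M. M (i, j) = Some (X $ i $ j))}"

definition completable :: "('n::finite, 'm::finite) partial_matrix \<Rightarrow> bool" where
  "completable M \<longleftrightarrow> completions M \<noteq> {}"

section \<open>The bipartite graph of a pattern\<close>

text \<open>The vertices of \<open>G(S)\<close> are \<open>Inl i\<close> for the rows and \<open>Inr j\<close> for the columns.\<close>

definition adjacency :: "('m \<times> 'n) set \<Rightarrow> (('m + 'n) \<times> ('m + 'n)) set" where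
  "adjacency S = (let E = {(Inl i, Inr j) | i j. (i, j) \<in> S} in E \<union> E\<inverse>)"

definition components_of_pattern :: "('m \<times> 'n) set \<Rightarrow> ('m + 'n) set set" where
  "components_of_pattern S = UNIV // (adjacency S)\<^sup>*"

definition positions :: "('m + 'n) set \<Rightarrow> ('m \<times> 'n) set" where
  "positions C = {(i, j). Inl i \<in> C \<and> Inr j \<in> C}"

definition has_edge :: "('m \<times> 'n) set \<Rightarrow> ('m + 'n) set \<Rightarrow> bool" where
  "has_edge S C \<longleftrightarrow> S \<inter> positions C \<noteq> {}"

definition isolated_vertex :: "('m \<times> 'n) set \<Rightarrow> ('m + 'n) set \<Rightarrow> bool" where
  "isolated_vertex S C \<longleftrightarrow> (\<exists>v. C = {v} \<and> v \<notin> Domain (adjacency S))"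

section \<open>The cycle-completion formula\<close>

text \<open>\<open>rs\<close> and \<open>cs\<close> list the rows \<open>r\<^sub>1, \<dots>, r\<^sub>k\<close> and columns \<open>c\<^sub>1, \<dots>, c\<^sub>k\<close> of a cycle with
  edges \<open>(r\<^sub>1,c\<^sub>1), (r\<^sub>1,c\<^sub>2), (r\<^sub>2,c\<^sub>2), \<dots>, (r\<^sub>k,c\<^sub>k), (r\<^sub>k,c\<^sub>1)\<close>;
  list positions start at \<open>0\<close>.\<close>

definition is_cycle :: "('m \<times> 'n) set \<Rightarrow> 'm list \<Rightarrow> 'n list \<Rightarrow> bool" where
  "is_cycle T rs cs \<longleftrightarrow>
     length rs = length cs \<and> length rs \<ge> 2 \<and> distinct rs \<and> distinct cs \<and>
     (\<forall>t < length rs. (rs ! t, cs ! t) \<in> T \<and> (rs ! t, cs ! (Suc t mod length rs)) \<in> T)"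

text \<open>The denominator omits the factor \<open>t = 0\<close>, which is the entry being computed.\<close>

definition cycle_value :: "('n, 'm) partial_matrix \<Rightarrow> 'm list \<Rightarrow> 'n list \<Rightarrow> real" where
  "cycle_value M rs cs =
     (\<Prod>t = 0..<length rs. the (M (rs ! t, cs ! (Suc t mod length rs)))) /
     (\<Prod>t = 1..<length rs. the (M (rs ! t, cs ! t)))"

text \<open>A relation rather than a function, since the formula depends on the choice of a cycle for
  each new entry. Every choice is admitted.\<close>

definition cycle_completion ::
  "('n, 'm) partial_matrix \<Rightarrow> ('n, 'm) partial_matrix \<Rightarrow> bool" where
  "cycle_completion M Mbar \<longleftrightarrow>
     dom Mbar = {(i, j). (Inl i, Inr j) \<in> (adjacency (dom M))\<^sup>*} \<and>
     M \<subseteq>\<^sub>m Mbar \<and>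
     (\<forall>(i, j) \<in> dom Mbar - dom M. \<exists>rs cs.
        is_cycle (insert (i, j) (dom M)) rs cs \<and> rs ! 0 = i \<and> cs ! 0 = j \<and>
        Mbar (i, j) = Some (cycle_value M rs cs))"

definition block_sum :: "('n::finite, 'm::finite) partial_matrix \<Rightarrow> ('m + 'n) set \<Rightarrow> real" where
  "block_sum Mbar C = (\<Sum>p \<in> positions C. the (Mbar p))"

section \<open>Semialgebraic sets and their dimension\<close>

definition basic_semialgebraic :: "'a::euclidean_space set \<Rightarrow> bool" where
  "basic_semialgebraic A \<longleftrightarrow>
     (\<exists>E P Q. finite E \<and> finite P \<and> finite Q \<and>
        (\<forall>f \<in> E \<union> P \<union> Q. real_polynomial_function f) \<and>
        A = {x. (\<forall>f\<in>E. f x = 0) \<and> (\<forall>f\<in>P. f x \<ge> 0) \<and> (\<forall>f\<in>Q. f x > 0)})"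

definition semialgebraic :: "'a::euclidean_space set \<Rightarrow> bool" where
  "semialgebraic A \<longleftrightarrow> (\<exists>F. finite F \<and> (\<forall>B\<in>F. basic_semialgebraic B) \<and> A = \<Union>F)"

definition semialgebraically_homeomorphic ::
  "'a::euclidean_space set \<Rightarrow> 'b::euclidean_space set \<Rightarrow> bool" where
  "semialgebraically_homeomorphic A B \<longleftrightarrow>
     semialgebraic A \<and> semialgebraic B \<and>
     (\<exists>f g. homeomorphism A B f g \<and> semialgebraic ((\<lambda>x. (x, f x)) ` A))"

text \<open>For a set \<open>B\<close> of \<open>d\<close> basis vectors, the open cube \<open>(0,1)\<^sup>d\<close> in the coordinate subspace
  spanned by \<open>B\<close>.\<close>

definition coordinate_cube :: "'a::euclidean_space set \<Rightarrow> 'a set" where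
  "coordinate_cube B = {x. (\<forall>b\<in>B. 0 < x \<bullet> b \<and> x \<bullet> b < 1) \<and> (\<forall>b\<in>Basis - B. x \<bullet> b = 0)}"

text \<open>The dimension of a semialgebraic set is the largest \<open>d\<close> such that the set contains a
  subset semialgebraically homeomorphic to \<open>(0,1)\<^sup>d\<close>, and \<open>-1\<close> for the empty set. As such a \<open>d\<close>
  never exceeds the ambient dimension, the cubes can be taken in the ambient space. Each point is
  a \<open>0\<close>-dimensional cube, so the maximum is over a nonempty finite set if \<open>A\<close> is nonempty.\<close>

definition semialgebraic_dim :: "'a::euclidean_space set \<Rightarrow> int" where
  "semialgebraic_dim A =
     (if A = {} then -1
      else int (Max {card B | B :: 'a set. B \<subseteq> Basis \<and>
             (\<exists>A' \<subseteq> A. semialgebraically_homeomorphic (coordinate_cube B) A')}))"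

end

theory Submission
  imports Defs
begin

text \<open>
  A completion is an outer product \<open>u v\<^sup>T\<close> of its vectors of row and column sums, each of total
  mass one. An entry \<open>(i, j)\<close> of the pattern fixes \<open>u\<^sub>i v\<^sub>j\<close>, so along the edges of a
  connected component the pair \<open>(u, v)\<close> is rigid up to replacing it by \<open>(t u, v / t)\<close>. Hence a
  completion is the same thing as a choice, for each component \<open>C\<close>, of a row mass \<open>x\<^sub>C \<ge> 0\<close> and a
  column mass \<open>y\<^sub>C \<ge> 0\<close> with \<open>x\<^sub>C y\<^sub>C = b\<^sub>C\<close>, where \<open>x\<^sub>C = 0\<close> if \<open>C\<close> has no row, \<open>y\<^sub>C = 0\<close> if
  it has no column, and both families of masses add up to one. This is the content of
  \<open>completion_determined\<close> and \<open>feasible_assemble\<close>; everything after that is about such masses.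

  If \<open>\<Sum>\<surd>b\<^sub>C = 1\<close>, then \<open>\<Sum>(\<surd>x\<^sub>C - \<surd>y\<^sub>C)\<^sup>2 = 2 - 2 \<Sum>\<surd>b\<^sub>C = 0\<close> forces \<open>x\<^sub>C = y\<^sub>C = \<surd>b\<^sub>C\<close>.

  If \<open>\<Sum>\<surd>b\<^sub>C < 1\<close> and there are at least two components, some row and some column lie in different
  components \<open>c\<^sub>1\<close> and \<open>c\<^sub>2\<close>. Fix the masses of all other components, and let \<open>P\<close> and \<open>Q\<close> be the
  row and column mass that is left. The cross products \<open>w = x\<^sub>1 y\<^sub>2\<close> and \<open>w' = x\<^sub>2 y\<^sub>1\<close> have sum
  \<open>P Q - b\<^sub>1 - b\<^sub>2\<close> and product \<open>b\<^sub>1 b\<^sub>2\<close>, so they are the roots of a known quadratic equation,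
  and \<open>w\<close> determines all four masses because \<open>x\<^sub>1 Q = b\<^sub>1 + w\<close> and so on. The completions therefore
  fall into two branches, \<open>w \<ge> w'\<close> and \<open>w \<le> w'\<close>, and on each of them the masses of the other
  components are coordinates (\<open>branch_unique\<close>). Conversely the roots are real and distinct when
  \<open>(\<surd>b\<^sub>1 + \<surd>b\<^sub>2)\<^sup>2 < P Q\<close>, which leaves an open box of admissible coordinates
  (\<open>coord_box_completion\<close>).

  With two components there are no coordinates left. If one of them is an isolated vertex, then
  \<open>w' = 0\<close> and only the branch \<open>w \<ge> w'\<close> occurs; if both contain edges, each branch contributes one
  completion. With \<open>s > 2\<close> components there are \<open>s - 2\<close> coordinates. On the branch \<open>w > w'\<close>,
  the completions with coordinates in the open box are the homeomorphic image of a cube. The graph of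
  this chart is cut out by polynomial conditions although the chart itself involves a square root;
  this bounds the dimension from below. For the upper bound, an open cube embedded in the set of
  completions either has a nonempty open part in the branch \<open>w > w'\<close> or lies entirely in the
  branch \<open>w \<le> w'\<close>. Either way the coordinates map an open set of that cube injectively into
  \<open>s - 2\<close> dimensions, and invariance of dimension applies.
\<close>

section \<open>Basic semialgebraic sets\<close>

lemma basic_semialgebraic_eq:
  assumes "real_polynomial_function f" "real_polynomial_function g"
  shows "basic_semialgebraic {x. f x = g x}"
  unfolding basic_semialgebraic_def
  by (rule exI[of _ "{\<lambda>x. f x - g x}"], rule exI[of _ "{}"], rule exI[of _ "{}"])
    (use assms in auto)

lemma basic_semialgebraic_le:
  assumes "real_polynomial_function f" "real_polynomial_function g"
  shows "basic_semialgebraic {x. f x \<le> g x}"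
  unfolding basic_semialgebraic_def
  by (rule exI[of _ "{}"], rule exI[of _ "{\<lambda>x. g x - f x}"], rule exI[of _ "{}"])
    (use assms in auto)

lemma basic_semialgebraic_less:
  assumes "real_polynomial_function f" "real_polynomial_function g"
  shows "basic_semialgebraic {x. f x < g x}"
  unfolding basic_semialgebraic_def
  by (rule exI[of _ "{}"], rule exI[of _ "{}"], rule exI[of _ "{\<lambda>x. g x - f x}"])
    (use assms in auto)

lemma basic_semialgebraicE:
  assumes "basic_semialgebraic {x. P x}"
  obtains E G H where "finite E" "finite G" "finite H"
    "\<forall>f \<in> E \<union> G \<union> H. real_polynomial_function f"
    "\<And>x. P x \<longleftrightarrow> (\<forall>f\<in>E. f x = 0) \<and> (\<forall>f\<in>G. f x \<ge> 0) \<and> (\<forall>f\<in>H. f x > 0)"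
  using assms unfolding basic_semialgebraic_def set_eq_iff mem_Collect_eq
  by (elim exE conjE) (rule that, auto)

lemma basic_semialgebraicI:
  assumes "finite E" "finite G" "finite H"
    "\<forall>f \<in> E \<union> G \<union> H. real_polynomial_function f"
    "\<And>x. P x \<longleftrightarrow> (\<forall>f\<in>E. f x = 0) \<and> (\<forall>f\<in>G. f x \<ge> 0) \<and> (\<forall>f\<in>H. f x > 0)"
  shows "basic_semialgebraic {x. P x}"
  unfolding basic_semialgebraic_def
  by (rule exI[of _ E], rule exI[of _ G], rule exI[of _ H]) (use assms in \<open>simp add: set_eq_iff\<close>)

lemma basic_semialgebraic_UNIV: "basic_semialgebraic {x. True}"
  unfolding basic_semialgebraic_def
  by (rule exI[of _ "{}"], rule exI[of _ "{}"], rule exI[of _ "{}"]) auto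

lemma basic_semialgebraic_conj:
  assumes "basic_semialgebraic {x. P x}" "basic_semialgebraic {x. Q x}"
  shows "basic_semialgebraic {x. P x \<and> Q x}"
proof -
  obtain E1 G1 H1 where 1: "finite E1" "finite G1" "finite H1"
    "\<forall>f \<in> E1 \<union> G1 \<union> H1. real_polynomial_function f"
    "\<And>x. P x \<longleftrightarrow> (\<forall>f\<in>E1. f x = 0) \<and> (\<forall>f\<in>G1. f x \<ge> 0) \<and> (\<forall>f\<in>H1. f x > 0)"
    by (rule basic_semialgebraicE[OF assms(1)]) (rule that)
  obtain E2 G2 H2 where 2: "finite E2" "finite G2" "finite H2"
    "\<forall>f \<in> E2 \<union> G2 \<union> H2. real_polynomial_function f"
    "\<And>x. Q x \<longleftrightarrow> (\<forall>f\<in>E2. f x = 0) \<and> (\<forall>f\<in>G2. f x \<ge> 0) \<and> (\<forall>f\<in>H2. f x > 0)"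
    by (rule basic_semialgebraicE[OF assms(2)]) (rule that)
  show ?thesis
    by (rule basic_semialgebraicI[of "E1 \<union> E2" "G1 \<union> G2" "H1 \<union> H2"])
      (use 1(1-4) 2(1-4) in \<open>auto simp: 1(5) 2(5)\<close>)
qed

lemma basic_semialgebraic_ball:
  assumes "finite I" "\<And>i. i \<in> I \<Longrightarrow> basic_semialgebraic {x. P i x}"
  shows "basic_semialgebraic {x. \<forall>i\<in>I. P i x}"
  using assms
proof (induction I)
  case empty
  show ?case using basic_semialgebraic_UNIV by simp
next
  case (insert i I)
  then show ?case using basic_semialgebraic_conj[of "P i" "\<lambda>x. \<forall>i\<in>I. P i x"] by simp
qed

lemma basic_semialgebraic_all:
  fixes P :: "'i::finite \<Rightarrow> 'a::euclidean_space \<Rightarrow> bool"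
  assumes "\<And>i. basic_semialgebraic {x. P i x}"
  shows "basic_semialgebraic {x. \<forall>i. P i x}"
  using basic_semialgebraic_ball[of UNIV P] assms by simp

lemma basic_semialgebraic_vimage:
  assumes "polynomial_function h" "basic_semialgebraic {x. P x}"
  shows "basic_semialgebraic {x. P (h x)}"
proof -
  obtain E G H where 1: "finite E" "finite G" "finite H"
    "\<forall>f \<in> E \<union> G \<union> H. real_polynomial_function f"
    "\<And>x. P x \<longleftrightarrow> (\<forall>f\<in>E. f x = 0) \<and> (\<forall>f\<in>G. f x \<ge> 0) \<and> (\<forall>f\<in>H. f x > 0)"
    by (rule basic_semialgebraicE[OF assms(2)]) (rule that)
  let ?c = "\<lambda>S. (\<lambda>f. f \<circ> h) ` S"
  have "\<forall>f \<in> ?c E \<union> ?c G \<union> ?c H. real_polynomial_function f"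
    using 1(4) real_polynomial_function_compose[OF assms(1)] by blast
  then show ?thesis
    using 1(1-3) by (intro basic_semialgebraicI[of "?c E" "?c G" "?c H"]) (simp_all add: 1(5))
qed

lemma basic_semialgebraic_imp_semialgebraic: "basic_semialgebraic A \<Longrightarrow> semialgebraic A"
  unfolding semialgebraic_def by (intro exI[of _ "{A}"]) auto

lemma real_polynomial_function_entry [intro]:
  "real_polynomial_function (\<lambda>X::real^'n::finite^'m::finite. X $ i $ j)"
  by (intro real_polynomial_function.intros(1) linear_conv_bounded_linear[THEN iffD1] linearI) auto

lemma real_polynomial_function_inner [intro]:
  "real_polynomial_function (\<lambda>x::'a::euclidean_space. x \<bullet> b)"
  by (intro real_polynomial_function.intros(1) bounded_linear_inner_left)

lemma basic_semialgebraic_coordinate_cube: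
  "basic_semialgebraic (coordinate_cube B)" if "B \<subseteq> Basis"
proof -
  have "finite B" using that finite_Basis finite_subset by blast
  then show ?thesis
    unfolding coordinate_cube_def
    by (intro basic_semialgebraic_conj basic_semialgebraic_ball basic_semialgebraic_less
        basic_semialgebraic_eq) auto
qed

section \<open>Coordinate cubes\<close>

lemma coordinate_cube_nonempty:
  assumes "B \<subseteq> Basis"
  shows "coordinate_cube B \<noteq> {}"
proof -
  have "(\<Sum>b\<in>B. (1/2) *\<^sub>R b) \<bullet> i = (if i \<in> B then 1/2 else 0)" if "i \<in> Basis" for i
  proof -
    have "(\<Sum>b\<in>B. (1/2) *\<^sub>R b) \<bullet> i = (\<Sum>b\<in>B. if b = i then 1/2 else 0)"
      unfolding inner_sum_left using assms that by (intro sum.cong) (auto simp: inner_Basis)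
    then show ?thesis using assms finite_subset[OF assms finite_Basis] by simp
  qed
  then have "(\<Sum>b\<in>B. (1/2) *\<^sub>R b) \<in> coordinate_cube B"
    unfolding coordinate_cube_def using assms by auto
  then show ?thesis by blast
qed

lemma openin_coordinate_cube:
  assumes "B \<subseteq> Basis"
  shows "openin (top_of_set (span B)) (coordinate_cube B)"
proof -
  have "finite B" using assms finite_Basis finite_subset by blast
  then have "open {x. \<forall>b\<in>B. 0 < x \<bullet> b \<and> x \<bullet> b < 1}"
    by (auto simp: Collect_ball_eq Collect_conj_eq
        intro!: open_INT open_Int open_Collect_less continuous_intros)
  moreover have "coordinate_cube B = span B \<inter> {x. \<forall>b\<in>B. 0 < x \<bullet> b \<and> x \<bullet> b < 1}"
    unfolding coordinate_cube_def span_substd_basis[OF assms] by auto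
  ultimately show ?thesis by auto
qed

text \<open>Invariance of dimension: a coordinate cube is open in the subspace spanned by its axes.\<close>

lemma coordinate_cube_open_subset_dim_le:
  fixes h :: "'a::euclidean_space \<Rightarrow> 'b::euclidean_space"
  assumes B: "B \<subseteq> Basis" and B': "B' \<subseteq> Basis"
    and U: "openin (top_of_set (coordinate_cube B)) U" "U \<noteq> {}"
    and h: "continuous_on U h" "inj_on h U" "h ` U \<subseteq> span B'"
  shows "card B \<le> card B'"
proof -
  have "dim (span B) \<le> dim (span B')"
  proof (rule invariance_of_dimension_subspaces)
    show "openin (top_of_set (span B)) U"
      using U(1) openin_coordinate_cube[OF B] openin_trans by blast
  qed (use U h in auto)
  then show ?thesis
    using dim_eq_card_independent independent_mono[OF independent_Basis] B B' by (metis dim_span)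
qed

section \<open>Rank-one matrices in the simplex\<close>

lemma rank_one_iff_minors:
  fixes X :: "real^'n^'m"
  shows "rank X = 1 \<longleftrightarrow> X \<noteq> 0 \<and> (\<forall>i j k l. X $ i $ j * X $ k $ l = X $ i $ l * X $ k $ j)"
proof
  assume r: "rank X = 1"
  then have "dim (rows X) = 1" by (simp add: row_rank_def)
  then obtain v where v: "rows X \<subseteq> span {v}"
    using basis_exists[of "rows X"] by (metis card_1_singletonE)
  have "\<exists>c. X $ i = c *\<^sub>R v" for i
  proof -
    have "row i X \<in> span {v}" using v by (auto simp: rows_def)
    then show ?thesis by (auto simp: span_singleton row_def vec_lambda_eta)
  qed
  then obtain c where c: "\<And>i. X $ i = c i *\<^sub>R v" by metis
  have "X \<noteq> 0" using r by auto
  then show "X \<noteq> 0 \<and> (\<forall>i j k l. X $ i $ j * X $ k $ l = X $ i $ l * X $ k $ j)"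
    by (simp add: c)
next
  assume a: "X \<noteq> 0 \<and> (\<forall>i j k l. X $ i $ j * X $ k $ l = X $ i $ l * X $ k $ j)"
  then obtain p q where pq: "X $ p $ q \<noteq> 0" by (metis vec_eq_iff zero_index)
  have "row i X = (X $ i $ q / X $ p $ q) *\<^sub>R X $ p" for i
    using a pq by (simp add: vec_eq_iff row_def field_simps)
  then have "rows X \<subseteq> span {X $ p}"
    by (auto simp: rows_def span_singleton)
  then have "rank X \<le> card {X $ p}"
    unfolding row_rank_def by (intro dim_le_card) auto
  moreover have "rank X \<noteq> 0" using a by (simp add: rank_eq_0)
  ultimately show "rank X = 1" by simp
qed

definition marginal :: "real^'n^'m \<Rightarrow> 'm::finite + 'n::finite \<Rightarrow> real" where
  "marginal X v = (case v of Inl i \<Rightarrow> \<Sum>j\<in>UNIV. X $ i $ j | Inr j \<Rightarrow> \<Sum>i\<in>UNIV. X $ i $ j)"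

text \<open>Rank one is replaced by the vanishing of the \<open>2 \<times> 2\<close> minors, which makes every condition
  polynomial.\<close>

lemma completions_iff:
  fixes M :: "('n::finite, 'm::finite) partial_matrix"
  shows "X \<in> completions M \<longleftrightarrow>
    (\<forall>i j. 0 \<le> X $ i $ j) \<and> (\<Sum>i\<in>UNIV. \<Sum>j\<in>UNIV. X $ i $ j) = 1 \<and>
    (\<forall>i j k l. X $ i $ j * X $ k $ l = X $ i $ l * X $ k $ j) \<and>
    (\<forall>p\<in>dom M. X $ fst p $ snd p = the (M p))"
proof -
  have "X \<noteq> 0" if "(\<Sum>i\<in>UNIV. \<Sum>j\<in>UNIV. X $ i $ j) = 1" using that by auto
  moreover have "(\<forall>(i, j) \<in> dom M. M (i, j) = Some (X $ i $ j)) \<longleftrightarrow>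
      (\<forall>p\<in>dom M. X $ fst p $ snd p = the (M p))"
    by (intro ball_cong) auto
  ultimately show ?thesis
    unfolding completions_def matrix_simplex_def rank_one_iff_minors by blast
qed

lemma completion_entry:
  assumes X: "X \<in> completions M" and r: "M (i, j) = Some r"
  shows "X $ i $ j = r"
proof -
  have "\<forall>p\<in>dom M. X $ fst p $ snd p = the (M p)" using X unfolding completions_iff by blast
  from bspec[OF this, of "(i, j)"] r show ?thesis by auto
qed

text \<open>Summing \<open>X\<^sub>i\<^sub>l X\<^sub>k\<^sub>j = X\<^sub>i\<^sub>j X\<^sub>k\<^sub>l\<close> over \<open>k\<close> and \<open>l\<close> leaves \<open>X\<^sub>i\<^sub>j\<close> on the right, since
  the entries of \<open>X\<close> have sum one.\<close>

lemma completion_eq_marginals: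
  assumes "X \<in> completions M"
  shows "X $ i $ j = marginal X (Inl i) * marginal X (Inr j)"
proof -
  have "marginal X (Inl i) * marginal X (Inr j) = (\<Sum>l\<in>UNIV. \<Sum>k\<in>UNIV. X $ i $ l * X $ k $ j)"
    unfolding marginal_def by (simp add: sum_product)
  also have "\<dots> = (\<Sum>l\<in>UNIV. \<Sum>k\<in>UNIV. X $ i $ j * X $ k $ l)"
    using assms unfolding completions_iff by (intro sum.cong refl) metis
  also have "\<dots> = X $ i $ j * (\<Sum>l\<in>UNIV. \<Sum>k\<in>UNIV. X $ k $ l)"
    by (simp add: sum_distrib_left)
  also have "(\<Sum>l\<in>UNIV. \<Sum>k\<in>UNIV. X $ k $ l) = 1"
    using assms unfolding completions_iff by (subst sum.swap) auto
  finally show ?thesis by simp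
qed

lemma marginal_nonneg: "X \<in> completions M \<Longrightarrow> 0 \<le> marginal X v"
  unfolding completions_iff marginal_def by (auto intro!: sum_nonneg split: sum.split)

lemma sum_marginals:
  assumes "X \<in> completions M"
  shows "(\<Sum>v | isl v = side. marginal X v) = 1"
proof -
  have "{v::'b + 'a. isl v} = Inl ` UNIV" "{v::'b + 'a. \<not> isl v} = Inr ` UNIV"
    by (auto simp: image_iff isl_def) (metis sum.exhaust)
  moreover have "(\<Sum>j\<in>UNIV. \<Sum>i\<in>UNIV. X $ i $ j) = 1"
    using assms unfolding completions_iff by (subst sum.swap) auto
  ultimately show ?thesis
    using assms unfolding completions_iff
    by (cases side) (auto simp: marginal_def sum.reindex)
qed

section \<open>Splitting mass between two blocks\<close>

text \<open>The square root of the discriminant of \<open>T\<^sup>2 - (c - b\<^sub>1 - b\<^sub>2) T + b\<^sub>1 b\<^sub>2\<close>, the equation whose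
  roots are the two cross products when the row and column masses left for the two blocks have
  product \<open>c\<close>.\<close>

definition root_disc :: "real \<Rightarrow> real \<Rightarrow> real \<Rightarrow> real" where
  "root_disc b1 b2 c = sqrt ((c - b1 - b2)\<^sup>2 - 4 * b1 * b2)"

text \<open>The hypothesis says \<open>c - b\<^sub>1 - b\<^sub>2 > 2 \<surd>(b\<^sub>1 b\<^sub>2)\<close>, so the discriminant is positive. If one block
  has sum zero, the smaller root vanishes; this is what makes the formulas below put no mass
  on a side that a component does not have.\<close>

lemma cross_products_exist:
  assumes b: "0 \<le> b1" "0 \<le> b2" and c: "(sqrt b1 + sqrt b2)\<^sup>2 < c"
  defines "w \<equiv> (c - b1 - b2 + root_disc b1 b2 c) / 2"
  defines "w' \<equiv> (c - b1 - b2 - root_disc b1 b2 c) / 2"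
  shows "w + w' = c - b1 - b2" "w * w' = b1 * b2" "w' < w" "0 \<le> w'" "b1 * b2 = 0 \<Longrightarrow> w' = 0"
proof -
  define h where "h = c - b1 - b2"
  have "(sqrt b1 + sqrt b2)\<^sup>2 = b1 + b2 + 2 * sqrt (b1 * b2)"
    using b by (simp add: power2_sum real_sqrt_mult)
  then have h: "2 * sqrt (b1 * b2) < h" using c unfolding h_def by simp
  moreover have q: "0 \<le> sqrt (b1 * b2)" using b by simp
  ultimately have "(2 * sqrt (b1 * b2))\<^sup>2 < h\<^sup>2" by (intro power_strict_mono) auto
  then have pos: "0 < h\<^sup>2 - 4 * b1 * b2" using b by (simp add: power_mult_distrib)
  define d where "d = root_disc b1 b2 c"
  have d: "d = sqrt (h\<^sup>2 - 4 * b1 * b2)" unfolding d_def root_disc_def h_def by simp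
  have dpos: "0 < d" using pos d by simp
  have d2: "d\<^sup>2 = h\<^sup>2 - 4 * b1 * b2" using pos d by simp
  have w: "w = (h + d) / 2" "w' = (h - d) / 2" unfolding w_def w'_def d_def h_def by auto
  show "w + w' = c - b1 - b2" using w h_def by (simp add: field_simps)
  show "w * w' = b1 * b2" using d2 unfolding w by (simp add: field_simps power2_eq_square)
  show "w' < w" using dpos w by simp
  have h0: "0 < h" using h q by linarith
  have "0 \<le> b1 * b2" using b by simp
  then have "d\<^sup>2 \<le> h\<^sup>2" using d2 by linarith
  then have "d \<le> h" by (rule power2_le_imp_le) (use h0 in simp)
  then show "0 \<le> w'" using w by simp
  show "w' = 0" if "b1 * b2 = 0"
  proof -
    have "d\<^sup>2 = h\<^sup>2" using d2 that by auto
    then have "d = h" using dpos h0 by (metis less_imp_le power2_eq_imp_eq)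
    then show ?thesis using w by simp
  qed
qed

lemma sum_product_determines:
  fixes w :: real
  assumes "w + w' = z + z'" "w * w' = z * z'" "w' \<le> w \<and> z' \<le> z \<or> w \<le> w' \<and> z \<le> z'"
  shows "w = z"
proof -
  have "(w - z) * (w - z') = w * w - w * (z + z') + z * z'" by (simp add: algebra_simps)
  also have "\<dots> = 0" unfolding assms(1,2)[symmetric] by (simp add: algebra_simps)
  finally have "w = z \<or> w = z'" by simp
  then show ?thesis using assms by auto
qed

text \<open>The cross products have the same sum and product on both sides, and the branch condition says
  which root is which, so they agree. They determine the masses by
  \<open>x\<^sub>1 (y\<^sub>1 + y\<^sub>2) = x\<^sub>1 y\<^sub>1 + x\<^sub>1 y\<^sub>2\<close> and its analogues, as long as the factor does not vanish; the
  degenerate cases are what the two implications for each solution are for.\<close>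

lemma two_block_masses_unique:
  fixes x1 :: real
  assumes "x1 + x2 = u1 + u2" "y1 + y2 = v1 + v2" "x1 * y1 = u1 * v1" "x2 * y2 = u2 * v2"
    and nn: "0 \<le> x1" "0 \<le> x2" "0 \<le> y1" "0 \<le> y2" "0 \<le> u1" "0 \<le> u2" "0 \<le> v1" "0 \<le> v2"
    and deg: "y2 = 0 \<longrightarrow> x2 = 0" "x1 = 0 \<longrightarrow> y1 = 0" "v2 = 0 \<longrightarrow> u2 = 0" "u1 = 0 \<longrightarrow> v1 = 0"
    and branch: "x2 * y1 \<le> x1 * y2 \<and> u2 * v1 \<le> u1 * v2 \<or> x1 * y2 \<le> x2 * y1 \<and> u1 * v2 \<le> u2 * v1"
  shows "x1 = u1 \<and> x2 = u2 \<and> y1 = v1 \<and> y2 = v2"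
proof -
  have "x1 * y2 + x2 * y1 = (x1 + x2) * (y1 + y2) - x1 * y1 - x2 * y2"
    by (simp add: algebra_simps)
  also have "\<dots> = (u1 + u2) * (v1 + v2) - u1 * v1 - u2 * v2" using assms by metis
  also have "\<dots> = u1 * v2 + u2 * v1" by (simp add: algebra_simps)
  finally have s: "x1 * y2 + x2 * y1 = u1 * v2 + u2 * v1" .
  have "(x1 * y2) * (x2 * y1) = (x1 * y1) * (x2 * y2)" by simp
  also have "\<dots> = (u1 * v2) * (u2 * v1)" using assms by simp
  finally have w: "x1 * y2 = u1 * v2"
    using sum_product_determines[OF s _ branch] by simp
  then have w': "x2 * y1 = u2 * v1" using s by simp
  have "x1 * (y1 + y2) = u1 * (v1 + v2)" using w assms(3) by (simp only: distrib_left)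
  then have x: "x1 * (y1 + y2) = u1 * (y1 + y2)" using assms(2) by simp
  have "(x1 + x2) * y1 = (u1 + u2) * v1" using w' assms(3) by (simp only: distrib_right)
  then have y: "y1 * (x1 + x2) = v1 * (x1 + x2)" using assms(1) by (simp add: mult.commute)
  have "x1 = u1"
  proof (cases "y1 + y2 = 0")
    case True
    then have "y2 = 0" "v2 = 0" using nn assms(2) by linarith+
    then show ?thesis using deg assms(1) by auto
  qed (use x in auto)
  moreover have "y1 = v1"
  proof (cases "x1 + x2 = 0")
    case True
    then have "x1 = 0" "u1 = 0" using nn assms(1) by linarith+
    then show ?thesis using deg assms(1) by auto
  qed (use y in auto)
  ultimately show ?thesis using assms(1,2) by auto
qed

section \<open>Row and column mass of a component\<close>

definition mass :: "real^'n^'m \<Rightarrow> bool \<Rightarrow> ('m::finite + 'n::finite) set \<Rightarrow> real" where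
  "mass X side C = (\<Sum>v | v \<in> C \<and> isl v = side. marginal X v)"

lemma mass_rows: "mass X True C = (\<Sum>i | Inl i \<in> C. marginal X (Inl i))"
proof -
  have "{v. v \<in> C \<and> isl v} = Inl ` {i. Inl i \<in> C}" by (auto simp: isl_def)
  then show ?thesis by (simp add: mass_def sum.reindex)
qed

lemma mass_columns: "mass X False C = (\<Sum>j | Inr j \<in> C. marginal X (Inr j))"
proof -
  have "{v. v \<in> C \<and> \<not> isl v} = Inr ` {j. Inr j \<in> C}"
    by (auto simp: image_iff) (metis sum.collapse(2))
  then show ?thesis by (simp add: mass_def sum.reindex)
qed

lemma mass_nonneg: "X \<in> completions M \<Longrightarrow> 0 \<le> mass X side C"
  unfolding mass_def by (intro sum_nonneg) (auto intro: marginal_nonneg)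

lemma mass_eq_0: "\<not> (\<exists>v\<in>C. isl v = side) \<Longrightarrow> mass X side C = 0"
  unfolding mass_def by (rule sum.neutral) auto

text \<open>The completion \<open>X0\<close> is the reference for how mass is distributed inside a component with
  edges; every other completion distributes it in the same proportions.\<close>

locale completion_problem =
  fixes M Mbar :: "('n::finite, 'm::finite) partial_matrix" and X0 :: "real^'n^'m"
  assumes X0: "X0 \<in> completions M"
    and entries_pos: "\<forall>v \<in> ran M. v > 0"
    and cyc: "cycle_completion M Mbar"
begin

abbreviation "comps \<equiv> components_of_pattern (dom M)"

abbreviation "b \<equiv> block_sum Mbar"

definition comp :: "'m + 'n \<Rightarrow> ('m + 'n) set" where
  "comp v = (adjacency (dom M))\<^sup>* `` {v}"

lemma comps_eq: "comps = range comp"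
  unfolding components_of_pattern_def quotient_def comp_def by auto

lemma finite_comps: "finite comps"
  unfolding comps_eq by simp

lemma comp_eq_iff: "comp v = comp w \<longleftrightarrow> (v, w) \<in> (adjacency (dom M))\<^sup>*"
proof -
  have "sym (adjacency (dom M))"
    unfolding adjacency_def Let_def by (rule sym_Un_converse)
  then have "equiv UNIV ((adjacency (dom M))\<^sup>*)"
    by (intro equivI refl_rtrancl sym_rtrancl trans_rtrancl) auto
  from equiv_class_eq_iff[OF this, of v w] show ?thesis unfolding comp_def by simp
qed

lemma mem_comps_iff:
  assumes "C \<in> comps"
  shows "v \<in> C \<longleftrightarrow> comp v = C"
proof -
  obtain w where "C = comp w" using assms comps_eq by auto
  moreover have "v \<in> comp w \<longleftrightarrow> comp w = comp v"
    unfolding comp_eq_iff by (simp add: comp_def)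
  ultimately show ?thesis by auto
qed

lemma comp_mem: "comp v \<in> comps"
  using comps_eq by auto

lemma comps_has_vertex:
  assumes "C \<in> comps"
  shows "\<exists>v. v \<in> C"
proof -
  obtain v where "C = comp v" using assms comps_eq by auto
  then have "v \<in> C" using mem_comps_iff[OF assms] by simp
  then show ?thesis ..
qed

lemma sum_over_comps:
  "(\<Sum>C\<in>comps. \<Sum>v | v \<in> C \<and> isl v = side. f v) = (\<Sum>v | isl v = side. f v)"
proof -
  have "(\<Sum>C\<in>comps. \<Sum>v | v \<in> C \<and> isl v = side. f v) =
      (\<Sum>C\<in>comps. \<Sum>v\<in>{v \<in> {v. isl v = side}. comp v = C}. f v)"
    by (intro sum.cong) (auto simp: mem_comps_iff)
  also have "\<dots> = (\<Sum>v | isl v = side. f v)"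
    by (rule sum.group) (auto simp: finite_comps comp_mem)
  finally show ?thesis .
qed

lemma sum_mass: "X \<in> completions M \<Longrightarrow> (\<Sum>C\<in>comps. mass X side C) = 1"
  unfolding mass_def sum_over_comps by (rule sum_marginals)

section \<open>Rigidity inside a component\<close>

lemma edge_marginals:
  assumes X: "X \<in> completions M" and e: "(v, w) \<in> adjacency (dom M)"
  shows "marginal X v * marginal X w = marginal X0 v * marginal X0 w"
    "0 < marginal X v" "0 < marginal X w"
proof -
  have *: "marginal X (Inl i) * marginal X (Inr j) = marginal X0 (Inl i) * marginal X0 (Inr j)
      \<and> 0 < marginal X (Inl i) \<and> 0 < marginal X (Inr j)" if ij: "(i, j) \<in> dom M" for i j
  proof -
    obtain r where r: "M (i, j) = Some r" using ij by auto
    have "0 < r" using entries_pos r by (auto simp: ran_def)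
    moreover have "X $ i $ j = r" "X0 $ i $ j = r"
      using completion_entry X X0 r by blast+
    ultimately have "marginal X (Inl i) * marginal X (Inr j) = r"
      "marginal X0 (Inl i) * marginal X0 (Inr j) = r" "0 < r"
      using completion_eq_marginals[OF X, of i j] completion_eq_marginals[OF X0, of i j] by auto
    moreover have "0 \<le> marginal X (Inl i)" "0 \<le> marginal X (Inr j)"
      using marginal_nonneg[OF X] by auto
    ultimately show ?thesis by (auto simp: less_le)
  qed
  have "\<exists>i j. (i, j) \<in> dom M \<and> (v = Inl i \<and> w = Inr j \<or> v = Inr j \<and> w = Inl i)"
    using e unfolding adjacency_def Let_def by blast
  then obtain i j where ij: "(i, j) \<in> dom M"
    and vw: "v = Inl i \<and> w = Inr j \<or> v = Inr j \<and> w = Inl i" by blast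
  show "marginal X v * marginal X w = marginal X0 v * marginal X0 w"
    "0 < marginal X v" "0 < marginal X w"
    using *[OF ij] vw by (auto simp: mult.commute)
qed

lemma marginal_pos:
  assumes "X \<in> completions M" "comp v = comp w" "v \<noteq> w"
  shows "0 < marginal X v"
  using assms(2,3) unfolding comp_eq_iff
  by (cases rule: converse_rtranclE) (auto dest: edge_marginals(2)[OF assms(1)])

text \<open>The ratio of \<open>X\<close> to \<open>X0\<close> on rows, and of \<open>X0\<close> to \<open>X\<close> on columns, is constant along edges
  because both matrices have the same entry there. A vertex without edges is only compared with
  itself.\<close>

lemma marginal_proportional:
  assumes X: "X \<in> completions M" and c: "comp v = comp w" and s: "isl v = isl w"
  shows "marginal X v * marginal X0 w = marginal X w * marginal X0 v"
proof (cases "v = w")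
  case False
  define \<rho> where "\<rho> u = (if isl u then marginal X u / marginal X0 u else marginal X0 u / marginal X u)"
    for u
  have step: "\<rho> u = \<rho> u'" if e: "(u, u') \<in> adjacency (dom M)" for u u'
  proof -
    have "isl u \<noteq> isl u'" using e unfolding adjacency_def Let_def by auto
    moreover have "marginal X u * marginal X u' = marginal X0 u * marginal X0 u'"
      using edge_marginals(1)[OF X e] .
    moreover have "0 < marginal X u" "0 < marginal X u'" "0 < marginal X0 u" "0 < marginal X0 u'"
      using edge_marginals[OF X e] edge_marginals[OF X0 e] by auto
    ultimately show ?thesis by (auto simp: \<rho>_def field_simps)
  qed
  have "(v, w) \<in> (adjacency (dom M))\<^sup>*" using c comp_eq_iff by simp
  then have "\<rho> v = \<rho> w" by induction (use step in auto)
  moreover have "0 < marginal X v" "0 < marginal X w" "0 < marginal X0 v" "0 < marginal X0 w"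
    using marginal_pos[OF X c False] marginal_pos[OF X0 c False]
      marginal_pos[OF X c[symmetric]] marginal_pos[OF X0 c[symmetric]] False by auto
  ultimately show ?thesis using s by (auto simp: \<rho>_def field_simps split: if_splits)
qed simp

lemma mass_pos:
  assumes X: "X \<in> completions M" and C: "C \<in> comps" and both: "\<And>s. \<exists>v\<in>C. isl v = s"
  shows "0 < mass X s C"
proof -
  obtain v where "v \<in> C" "isl v = s" using both[of s] by blast
  moreover obtain w where "w \<in> C" "isl w = (\<not> s)" using both[of "\<not> s"] by blast
  ultimately have "0 < marginal X v" using marginal_pos[OF X, of v w] mem_comps_iff[OF C] by auto
  then show ?thesis
    unfolding mass_def using \<open>v \<in> C\<close> \<open>isl v = s\<close> marginal_nonneg[OF X]
    by (intro sum_pos2[of _ v]) auto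
qed

text \<open>The share of a vertex in the mass of its component and side. It is the same for all completions
  and is read off from \<open>X0\<close>; only an isolated vertex can have mass \<open>0\<close> on its own side there, and
  its share is \<open>1\<close>.\<close>

definition profile :: "'m + 'n \<Rightarrow> real" where
  "profile v = (if mass X0 (isl v) (comp v) = 0 then 1 else marginal X0 v / mass X0 (isl v) (comp v))"

lemma profile_nonneg: "0 \<le> profile v"
  unfolding profile_def using marginal_nonneg[OF X0] mass_nonneg[OF X0] by simp

lemma zero_mass_singleton:
  assumes "mass X0 (isl v) (comp v) = 0"
  shows "{w. w \<in> comp v \<and> isl w = isl v} = {v}"
proof (rule ccontr)
  have v: "v \<in> comp v" using mem_comps_iff[OF comp_mem] by auto
  assume "\<not> ?thesis"
  then obtain w where "w \<in> comp v" "w \<noteq> v" using v by auto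
  then have "0 < marginal X0 v" 
    using marginal_pos[OF X0, of v w] mem_comps_iff[OF comp_mem] by auto
  then have "0 < mass X0 (isl v) (comp v)"
    unfolding mass_def using v marginal_nonneg[OF X0] by (intro sum_pos2[of _ v]) auto
  then show False using assms by simp
qed

lemma marginal_eq_profile:
  assumes X: "X \<in> completions M"
  shows "marginal X v = mass X (isl v) (comp v) * profile v"
proof (cases "mass X0 (isl v) (comp v) = 0")
  case True
  then show ?thesis using zero_mass_singleton[OF True] by (simp add: profile_def mass_def)
next
  case False
  have "marginal X v * mass X0 (isl v) (comp v) = mass X (isl v) (comp v) * marginal X0 v"
    unfolding mass_def sum_distrib_left sum_distrib_right
  proof (intro sum.cong refl)
    fix w assume w: "w \<in> {w. w \<in> comp v \<and> isl w = isl v}"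
    then have "comp v = comp w" using mem_comps_iff[OF comp_mem] by auto
    then show "marginal X v * marginal X0 w = marginal X w * marginal X0 v"
      using w by (intro marginal_proportional[OF X]) auto
  qed
  then show ?thesis using False by (simp add: profile_def field_simps)
qed

lemma sum_profile:
  assumes C: "C \<in> comps" and v: "v \<in> C" "isl v = s"
  shows "(\<Sum>w | w \<in> C \<and> isl w = s. profile w) = 1"
proof -
  have Cv: "C = comp v" using v mem_comps_iff[OF C] by simp
  show ?thesis
  proof (cases "mass X0 s C = 0")
    case True
    then have "{w. w \<in> C \<and> isl w = s} = {v}" using zero_mass_singleton[of v] Cv v by simp
    then show ?thesis using True Cv v by (simp add: profile_def)
  next
    case False
    have "(\<Sum>w | w \<in> C \<and> isl w = s. profile w) =
        (\<Sum>w | w \<in> C \<and> isl w = s. marginal X0 w / mass X0 s C)"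
    proof (intro sum.cong refl)
      fix w assume w: "w \<in> {w. w \<in> C \<and> isl w = s}"
      then have "comp w = C" using mem_comps_iff[OF C] by auto
      then show "profile w = marginal X0 w / mass X0 s C" using w False by (simp add: profile_def)
    qed
    also have "\<dots> = mass X0 s C / mass X0 s C"
      unfolding sum_divide_distrib[symmetric] by (simp add: mass_def)
    finally show ?thesis using False by simp
  qed
qed

lemma completion_determined:
  assumes "X \<in> completions M" "Y \<in> completions M"
    and "\<And>C s. C \<in> comps \<Longrightarrow> mass X s C = mass Y s C"
  shows "X = Y"
proof -
  have "marginal X v = marginal Y v" for v
    using assms comp_mem by (simp add: marginal_eq_profile)
  then show ?thesis
    by (simp add: vec_eq_iff completion_eq_marginals[OF assms(1)] completion_eq_marginals[OF assms(2)])
qed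

section \<open>The cycle-completion formula\<close>

text \<open>With \<open>X\<^sub>i\<^sub>j = u\<^sub>i v\<^sub>j\<close> each column of the cycle occurs once in the numerator, and each row and column
  other than those of the new entry cancels against the denominator. Those factors are positive
  since all other positions of the cycle are in the pattern.\<close>

lemma cycle_value_eq:
  assumes X: "X \<in> completions M"
    and cy: "is_cycle (insert (rs ! 0, cs ! 0) (dom M)) rs cs"
  shows "cycle_value M rs cs = X $ (rs ! 0) $ (cs ! 0)"
proof -
  define k where "k = length rs"
  have k: "2 \<le> k" "length cs = k" "distinct rs" "distinct cs"
    using cy unfolding is_cycle_def k_def by auto
  have 1: "(rs ! t, cs ! t) \<in> dom M" if "1 \<le> t" "t < k" for t
  proof -
    have "rs ! t \<noteq> rs ! 0" using that k k_def nth_eq_iff_index_eq[of rs t 0] by (cases rs) auto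
    then show ?thesis using cy that unfolding is_cycle_def k_def by auto
  qed
  have 2: "(rs ! t, cs ! (Suc t mod k)) \<in> dom M" if "t < k" for t
  proof -
    have "rs ! t \<noteq> rs ! 0 \<or> cs ! (Suc t mod k) \<noteq> cs ! 0"
    proof (cases "t = 0")
      case True
      then show ?thesis using k nth_eq_iff_index_eq[of cs 1 0] by (cases cs) auto
    next
      case False
      then show ?thesis using that k k_def nth_eq_iff_index_eq[of rs t 0] by (cases rs) auto
    qed
    then show ?thesis using cy that unfolding is_cycle_def k_def by auto
  qed
  have val: "the (M (i, j)) = marginal X (Inl i) * marginal X (Inr j)"
    and posm: "0 < marginal X (Inl i)" "0 < marginal X (Inr j)" if "(i, j) \<in> dom M" for i j
  proof -
    have "(Inl i, Inr j) \<in> adjacency (dom M)" using that unfolding adjacency_def Let_def by blast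
    from edge_marginals[OF X this]
    show "0 < marginal X (Inl i)" "0 < marginal X (Inr j)" by auto
    have "the (M (i, j)) = X $ i $ j" using completion_entry[OF X] that by auto
    then show "the (M (i, j)) = marginal X (Inl i) * marginal X (Inr j)"
      using completion_eq_marginals[OF X] by simp
  qed
  let ?u = "\<lambda>t. marginal X (Inl (rs ! t))" and ?v = "\<lambda>t. marginal X (Inr (cs ! t))"
  obtain k' where k': "k = Suc k'" using k by (cases k) auto
  \<comment> \<open>The successor map modulo \<open>k\<close> permutes the positions.\<close>
  have shift: "(\<Prod>t = 0..<k. ?v (Suc t mod k)) = (\<Prod>t = 0..<k. ?v t)"
  proof -
    have "(\<Prod>t = 0..<k'. ?v (Suc t mod k)) = (\<Prod>t = 0..<k'. ?v (Suc t))"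
      unfolding k' by (intro prod.cong) auto
    then have "(\<Prod>t = 0..<k. ?v (Suc t mod k)) = (\<Prod>t = 0..<k'. ?v (Suc t)) * ?v 0"
      unfolding k' by simp
    also have "\<dots> = (\<Prod>t = 0..<k. ?v t)"
      unfolding k' prod.atLeast0_lessThan_Suc_shift by (simp add: mult.commute)
    finally show ?thesis .
  qed
  have head: "(\<Prod>t = 0..<k. f t) = f 0 * (\<Prod>t = 1..<k. f t)" for f :: "nat \<Rightarrow> real"
    using k by (simp add: prod.atLeast_Suc_lessThan)
  have num: "(\<Prod>t = 0..<k. the (M (rs ! t, cs ! (Suc t mod k)))) =
      (?u 0 * ?v 0) * ((\<Prod>t = 1..<k. ?u t) * (\<Prod>t = 1..<k. ?v t))"
  proof -
    have "(\<Prod>t = 0..<k. the (M (rs ! t, cs ! (Suc t mod k)))) =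
        (\<Prod>t = 0..<k. ?u t * ?v (Suc t mod k))"
      by (intro prod.cong refl val 2) auto
    also have "\<dots> = (\<Prod>t = 0..<k. ?u t) * (\<Prod>t = 0..<k. ?v t)"
      by (simp only: prod.distrib shift)
    finally show ?thesis by (simp add: head)
  qed
  have den: "(\<Prod>t = 1..<k. the (M (rs ! t, cs ! t))) = (\<Prod>t = 1..<k. ?u t) * (\<Prod>t = 1..<k. ?v t)"
    unfolding prod.distrib[symmetric] by (intro prod.cong refl val 1) auto
  have "0 < (\<Prod>t = 1..<k. ?u t)" "0 < (\<Prod>t = 1..<k. ?v t)"
    by (auto intro!: prod_pos posm[OF 1])
  then have "(\<Prod>t = 1..<k. ?u t) * (\<Prod>t = 1..<k. ?v t) \<noteq> 0"
    by (intro less_imp_neq[symmetric] mult_pos_pos)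
  then have "cycle_value M rs cs = ?u 0 * ?v 0"
    unfolding cycle_value_def k_def[symmetric] num den by (rule nonzero_mult_div_cancel_right)
  then show ?thesis using completion_eq_marginals[OF X] by simp
qed

lemma block_entry:
  assumes X: "X \<in> completions M" and ij: "(i, j) \<in> dom Mbar"
  shows "Mbar (i, j) = Some (X $ i $ j)"
proof (cases "(i, j) \<in> dom M")
  case True
  then have "Mbar (i, j) = M (i, j)" using cyc unfolding cycle_completion_def map_le_def by simp
  moreover have "X $ i $ j = the (M (i, j))" using completion_entry[OF X] True by auto
  ultimately show ?thesis using True by auto
next
  case False
  have "\<forall>(i, j) \<in> dom Mbar - dom M. \<exists>rs cs. is_cycle (insert (i, j) (dom M)) rs cs \<and>
        rs ! 0 = i \<and> cs ! 0 = j \<and> Mbar (i, j) = Some (cycle_value M rs cs)"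
    using cyc unfolding cycle_completion_def by (elim conjE)
  from bspec[OF this, of "(i, j)"]
  have "\<exists>rs cs. is_cycle (insert (i, j) (dom M)) rs cs \<and> rs ! 0 = i \<and> cs ! 0 = j \<and>
        Mbar (i, j) = Some (cycle_value M rs cs)"
    using ij False by auto
  then show ?thesis using cycle_value_eq[OF X] by auto
qed

text \<open>Both factors of every entry of the block range independently over the rows and the columns of
  the component.\<close>

lemma block_sum_eq_mass_product:
  assumes X: "X \<in> completions M" and C: "C \<in> comps"
  shows "b C = mass X True C * mass X False C"
proof -
  have pos: "positions C = {i. Inl i \<in> C} \<times> {j. Inr j \<in> C}"
    unfolding positions_def by auto
  have "b C = (\<Sum>(i, j)\<in>positions C. marginal X (Inl i) * marginal X (Inr j))"
    unfolding block_sum_def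
  proof (rule sum.cong[OF refl], clarify)
    fix i j assume "(i, j) \<in> positions C"
    then have "comp (Inl i) = comp (Inr j)"
      using mem_comps_iff[OF C] unfolding positions_def by auto
    then have "(i, j) \<in> dom Mbar"
      using cyc comp_eq_iff unfolding cycle_completion_def by auto
    then show "the (Mbar (i, j)) = marginal X (Inl i) * marginal X (Inr j)"
      using block_entry[OF X] completion_eq_marginals[OF X] by simp
  qed
  also have "\<dots> = mass X True C * mass X False C"
    unfolding pos mass_rows mass_columns sum_product sum.cartesian_product ..
  finally show ?thesis .
qed

lemma block_sum_nonneg: "C \<in> comps \<Longrightarrow> 0 \<le> b C"
  using block_sum_eq_mass_product[OF X0] mass_nonneg[OF X0] by simp

lemma block_sum_pos:
  assumes "C \<in> comps" "\<And>s. \<exists>v\<in>C. isl v = s"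
  shows "0 < b C"
  using block_sum_eq_mass_product[OF X0 assms(1)] mass_pos[OF X0 assms] by simp

lemma block_sum_eq_0:
  assumes "C \<in> comps" "\<not> (\<exists>v\<in>C. isl v = s)"
  shows "b C = 0"
  using block_sum_eq_mass_product[OF X0 assms(1)] mass_eq_0[OF assms(2)] by (cases s) auto

section \<open>Completions from component masses\<close>

definition assemble :: "(bool \<Rightarrow> ('m + 'n) set \<Rightarrow> real) \<Rightarrow> real^'n^'m" where
  "assemble m = (\<chi> i j. (m True (comp (Inl i)) * profile (Inl i)) *
    (m False (comp (Inr j)) * profile (Inr j)))"

definition feasible :: "(bool \<Rightarrow> ('m + 'n) set \<Rightarrow> real) \<Rightarrow> bool" where
  "feasible m \<longleftrightarrow>
    (\<forall>C\<in>comps. m True C * m False C = b C \<and>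
      (\<forall>s. 0 \<le> m s C \<and> (\<not> (\<exists>v\<in>C. isl v = s) \<longrightarrow> m s C = 0))) \<and>
    (\<forall>s. (\<Sum>C\<in>comps. m s C) = 1)"

text \<open>A position of the pattern lies inside one component, where only the product of the two masses
  matters; it equals the block sum, as it does for \<open>X0\<close>, so the specified entries come out right.\<close>

lemma feasible_assemble:
  assumes m: "feasible m"
  shows "assemble m \<in> completions M" "\<And>C s. C \<in> comps \<Longrightarrow> mass (assemble m) s C = m s C"
proof -
  define f where "f v = m (isl v) (comp v) * profile v" for v
  have nonneg: "0 \<le> f v" for v
    unfolding f_def using m comp_mem profile_nonneg unfolding feasible_def by simp
  have part: "(\<Sum>v | v \<in> C \<and> isl v = s. f v) = m s C" if C: "C \<in> comps" for C s
  proof -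
    have "(\<Sum>v | v \<in> C \<and> isl v = s. f v) = m s C * (\<Sum>v | v \<in> C \<and> isl v = s. profile v)"
      unfolding sum_distrib_left f_def
      using mem_comps_iff[OF C] by (intro sum.cong) auto
    also have "\<dots> = m s C"
    proof (cases "\<exists>v\<in>C. isl v = s")
      case True
      then show ?thesis using sum_profile[OF C] by auto
    next
      case False
      then show ?thesis using m C unfolding feasible_def by simp
    qed
    finally show ?thesis .
  qed
  have total: "(\<Sum>v | isl v = s. f v) = 1" for s
    using m part unfolding sum_over_comps[symmetric] feasible_def by simp
  have rows: "{v::'m + 'n. isl v = True} = range Inl" and cols: "{v::'m + 'n. isl v = False} = range Inr"
    by (auto simp: image_iff isl_def) (metis sum.exhaust)
  have sum_rows: "(\<Sum>i\<in>UNIV. f (Inl i)) = 1" and sum_cols: "(\<Sum>j\<in>UNIV. f (Inr j)) = 1"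
    using total[of True] total[of False] unfolding rows cols by (simp_all add: sum.reindex)
  have entry: "assemble m $ i $ j = f (Inl i) * f (Inr j)" for i j
    by (simp add: assemble_def f_def)
  have marg: "marginal (assemble m) v = f v" for v
    using sum_rows sum_cols
    by (cases v) (simp_all add: marginal_def entry flip: sum_distrib_left sum_distrib_right)
  show "mass (assemble m) s C = m s C" if "C \<in> comps" for C s
    using part[OF that] by (simp add: mass_def marg)
  show "assemble m \<in> completions M"
    unfolding completions_iff entry
  proof (intro conjI allI ballI)
    show "(\<Sum>i\<in>UNIV. \<Sum>j\<in>UNIV. f (Inl i) * f (Inr j)) = 1"
      by (simp add: sum_rows sum_cols flip: sum_distrib_left sum_distrib_right)
  next
    fix p assume p: "p \<in> dom M"
    obtain i j where ij: "p = (i, j)" by fastforce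
    have e: "(Inl i, Inr j) \<in> adjacency (dom M)"
      using p ij unfolding adjacency_def Let_def by blast
    define C where "C = comp (Inl i)"
    have C: "C \<in> comps" "comp (Inl i) = C" "comp (Inr j) = C"
      using e comp_eq_iff[of "Inl i" "Inr j"] comp_mem unfolding C_def by auto
    have both: "\<exists>v\<in>C. isl v = s" for s
      using mem_comps_iff[OF C(1)] C(2,3)
      by (intro bexI[of _ "if s then Inl i else Inr j"]) auto
    have bC: "b C \<noteq> 0" "m True C * m False C = b C" "mass X0 True C * mass X0 False C = b C"
      using block_sum_pos[OF C(1) both] m C block_sum_eq_mass_product[OF X0 C(1)]
      unfolding feasible_def by auto
    have "f (Inl i) * f (Inr j) =
        (m True C * m False C) * (profile (Inl i) * profile (Inr j))"
      by (simp add: f_def C)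
    also have "\<dots> = (mass X0 True C * profile (Inl i)) * (mass X0 False C * profile (Inr j))"
      using bC by simp
    also have "\<dots> = marginal X0 (Inl i) * marginal X0 (Inr j)"
      using marginal_eq_profile[OF X0, of "Inl i"] marginal_eq_profile[OF X0, of "Inr j"] C by simp
    also have "\<dots> = X0 $ i $ j" using completion_eq_marginals[OF X0] by simp
    also have "\<dots> = the (M p)" using completion_entry[OF X0] p ij by auto
    finally show "f (Inl (fst p)) * f (Inr (snd p)) = the (M p)" using ij by simp
  qed (use nonneg in auto)
qed

section \<open>Two branches of completions\<close>

definition has_row :: "('m + 'n) set \<Rightarrow> bool" where
  "has_row C \<longleftrightarrow> (\<exists>v\<in>C. isl v)"

definition has_column :: "('m + 'n) set \<Rightarrow> bool" where
  "has_column C \<longleftrightarrow> (\<exists>v\<in>C. \<not> isl v)"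

lemma ex_side_iff: "(\<exists>v\<in>C. isl v = s) \<longleftrightarrow> (if s then has_row C else has_column C)"
  by (cases s) (auto simp: has_row_def has_column_def)

lemma row_or_column: "C \<in> comps \<Longrightarrow> has_row C \<or> has_column C"
  using comps_has_vertex unfolding has_row_def has_column_def by blast

text \<open>A component with a row is coordinatised by its row mass, an isolated column by its own mass.\<close>

definition coord :: "real^'n^'m \<Rightarrow> ('m + 'n) set \<Rightarrow> real" where
  "coord X C = mass X (has_row C) C"

text \<open>Recovers both masses of a component from its coordinate. When the coordinate is \<open>0\<close>, so is the
  block sum, and the convention \<open>0 / 0 = 0\<close> gives the correct second mass.\<close>

definition spread :: "(('m + 'n) set \<Rightarrow> real) \<Rightarrow> bool \<Rightarrow> ('m + 'n) set \<Rightarrow> real" where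
  "spread z s C = (if s = has_row C then z C else b C / z C)"

lemma mass_eq_spread:
  assumes X: "X \<in> completions M" and C: "C \<in> comps"
  shows "mass X s C = spread (coord X) s C"
proof (cases "s = has_row C")
  case False
  have prod: "b C = mass X s C * coord X C"
    using block_sum_eq_mass_product[OF X C] False unfolding coord_def
    by (cases s) (auto simp: mult.commute)
  show ?thesis
  proof (cases "coord X C = 0")
    case True
    have "\<not> (\<exists>v\<in>C. isl v = s)"
    proof
      assume "\<exists>v\<in>C. isl v = s"
      then have "\<exists>v\<in>C. isl v = r" for r
        using False row_or_column[OF C] unfolding ex_side_iff by (cases s; cases r) auto
      from mass_pos[OF X C this, of "has_row C"] show False using True unfolding coord_def by simp
    qed
    from mass_eq_0[OF this] show ?thesis using True False by (simp add: spread_def)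
  qed (use prod False in \<open>simp add: spread_def\<close>)
qed (simp add: spread_def coord_def)

lemma sum_comps_split:
  assumes "c1 \<in> comps" "c2 \<in> comps" "c1 \<noteq> c2"
  shows "(\<Sum>C\<in>comps. f C) = f c1 + f c2 + (\<Sum>C\<in>comps - {c1, c2}. f C)"
proof -
  have "(\<Sum>C\<in>comps. f C) = sum f {c1, c2} + sum f (comps - {c1, c2})"
    using assms finite_comps by (intro sum.subset_diff[of "{c1, c2}", THEN trans] add.commute) auto
  then show ?thesis using assms by simp
qed

definition remainder :: "('m + 'n) set \<Rightarrow> ('m + 'n) set \<Rightarrow> (('m + 'n) set \<Rightarrow> real) \<Rightarrow> bool \<Rightarrow> real" where
  "remainder c1 c2 z s = 1 - (\<Sum>C\<in>comps - {c1, c2}. spread z s C)"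

text \<open>The other components get their prescribed masses. For \<open>c1\<close> and \<open>c2\<close> the equations
  \<open>x\<^sub>1 Q = b\<^sub>1 + w\<close>, \<open>y\<^sub>1 P = b\<^sub>1 + w'\<close>, \<open>x\<^sub>2 Q = b\<^sub>2 + w'\<close>, \<open>y\<^sub>2 P = b\<^sub>2 + w\<close> are solved with \<open>w\<close> the
  larger and \<open>w'\<close> the smaller root.\<close>

definition branch_masses ::
  "('m + 'n) set \<Rightarrow> ('m + 'n) set \<Rightarrow> (('m + 'n) set \<Rightarrow> real) \<Rightarrow> bool \<Rightarrow> ('m + 'n) set \<Rightarrow> real" where
  "branch_masses c1 c2 z s C =
    (let P = remainder c1 c2 z True; Q = remainder c1 c2 z False;
         h = P * Q - b c1 - b c2; d = root_disc (b c1) (b c2) (P * Q)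
     in if C = c1 then (if s then (b c1 + (h + d) / 2) / Q else (b c1 + (h - d) / 2) / P)
        else if C = c2 then (if s then (b c2 + (h - d) / 2) / Q else (b c2 + (h + d) / 2) / P)
        else spread z s C)"

lemma feasible_branch_masses:
  assumes c: "c1 \<in> comps" "c2 \<in> comps" "c1 \<noteq> c2" "has_row c1" "has_column c2"
    and z: "\<And>C. C \<in> comps - {c1, c2} \<Longrightarrow> 0 \<le> z C \<and> (0 < b C \<longrightarrow> 0 < z C)"
    and P: "0 < remainder c1 c2 z True" and Q: "0 < remainder c1 c2 z False"
    and PQ: "(sqrt (b c1) + sqrt (b c2))\<^sup>2 < remainder c1 c2 z True * remainder c1 c2 z False"
  defines "m \<equiv> branch_masses c1 c2 z"
  shows "feasible m" "m True c2 * m False c1 < m True c1 * m False c2"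
proof -
  define P where "P = remainder c1 c2 z True"
  define Q where "Q = remainder c1 c2 z False"
  define b1 where "b1 = b c1"
  define b2 where "b2 = b c2"
  define w where "w = (P * Q - b1 - b2 + root_disc b1 b2 (P * Q)) / 2"
  define w' where "w' = (P * Q - b1 - b2 - root_disc b1 b2 (P * Q)) / 2"
  have b: "0 \<le> b1" "0 \<le> b2" using block_sum_nonneg c by (auto simp: b1_def b2_def)
  have pos: "0 < P" "0 < Q" using P Q by (auto simp: P_def Q_def)
  have "(sqrt b1 + sqrt b2)\<^sup>2 < P * Q" using PQ unfolding P_def Q_def b1_def b2_def .
  note w = cross_products_exist[OF b this, folded w_def w'_def]
  have w0: "0 \<le> w" using w(3,4) by simp
  have m1: "m True c1 = (b1 + w) / Q" "m False c1 = (b1 + w') / P"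
    and m2: "m True c2 = (b2 + w') / Q" "m False c2 = (b2 + w) / P"
    and m3: "\<And>C s. C \<in> comps - {c1, c2} \<Longrightarrow> m s C = spread z s C"
    using c(3) unfolding m_def branch_masses_def Let_def w_def w'_def b1_def b2_def P_def Q_def
    by auto
  have sumT: "(b1 + w) / Q + (b2 + w') / Q = P"
  proof -
    have "(b1 + w) + (b2 + w') = P * Q" using w(1) by simp
    then show ?thesis using pos by (simp add: add_divide_distrib[symmetric])
  qed
  have sumF: "(b1 + w') / P + (b2 + w) / P = Q"
  proof -
    have "(b1 + w') + (b2 + w) = P * Q" using w(1) by simp
    then show ?thesis using pos by (simp add: add_divide_distrib[symmetric])
  qed
  have "(b1 + w) * (b1 + w') = b1 * b1 + b1 * (w + w') + w * w'" by (simp add: algebra_simps)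
  also have "\<dots> = b1 * (P * Q)" unfolding w(1,2) by (simp add: algebra_simps)
  finally have prod1: "(b1 + w) / Q * ((b1 + w') / P) = b1" using pos by (simp add: field_simps)
  have "(b2 + w') * (b2 + w) = b2 * b2 + b2 * (w + w') + w * w'" by (simp add: algebra_simps)
  also have "\<dots> = b2 * (P * Q)" unfolding w(1,2) by (simp add: algebra_simps)
  finally have prod2: "(b2 + w') / Q * ((b2 + w) / P) = b2" using pos by (simp add: field_simps)
  have rest: "spread z True C * spread z False C = b C \<and>
      (\<forall>s. 0 \<le> spread z s C \<and> (\<not> (\<exists>v\<in>C. isl v = s) \<longrightarrow> spread z s C = 0))"
    if C: "C \<in> comps - {c1, c2}" for C
  proof (intro conjI allI impI)
    have C': "C \<in> comps" using C by simp
    have z0: "z C = 0 \<Longrightarrow> b C = 0" using z[OF C] block_sum_nonneg[OF C'] by auto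
    then show "spread z True C * spread z False C = b C"
      by (cases "z C = 0") (auto simp: spread_def)
    show "0 \<le> spread z s C" for s
      using z[OF C] block_sum_nonneg[OF C'] by (simp add: spread_def)
    show "spread z s C = 0" if "\<not> (\<exists>v\<in>C. isl v = s)" for s
    proof -
      have "b C = 0" using block_sum_eq_0[OF C' that] .
      moreover have "s \<noteq> has_row C" using that row_or_column[OF C'] unfolding ex_side_iff by (cases s) auto
      ultimately show ?thesis by (simp add: spread_def)
    qed
  qed
  show "feasible m"
    unfolding feasible_def
  proof (intro conjI ballI allI)
    fix s
    show "(\<Sum>C\<in>comps. m s C) = 1"
    proof -
      have "(\<Sum>C\<in>comps - {c1, c2}. m s C) = (\<Sum>C\<in>comps - {c1, c2}. spread z s C)"
        by (intro sum.cong refl m3)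
      also have "\<dots> = 1 - (if s then P else Q)" by (simp add: P_def Q_def remainder_def)
      finally show ?thesis
        unfolding sum_comps_split[OF c(1-3)] using sumT sumF by (cases s) (simp_all add: m1 m2)
    qed
  next
    fix C assume C: "C \<in> comps"
    consider "C = c1" | "C = c2" | "C \<in> comps - {c1, c2}" using C by blast
    note cases = this
    show "m True C * m False C = b C"
      using cases
    proof cases
      case 1
      then show ?thesis using m1 prod1 b1_def by simp
    next
      case 2
      then show ?thesis using m2 prod2 b2_def by simp
    next
      case 3
      then show ?thesis using m3[OF 3] rest[OF 3] by simp
    qed
    fix s
    show "0 \<le> m s C"
      using cases
    proof cases
      case 1
      then show ?thesis using m1 b w0 w(4) pos by (cases s) simp_all
    next
      case 2
      then show ?thesis using m2 b w0 w(4) pos by (cases s) simp_all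
    next
      case 3
      then show ?thesis using m3[OF 3] rest[OF 3] by simp
    qed
    show "\<not> (\<exists>v\<in>C. isl v = s) \<longrightarrow> m s C = 0"
    proof
      assume no: "\<not> (\<exists>v\<in>C. isl v = s)"
      note b0 = block_sum_eq_0[OF C no]
      show "m s C = 0"
        using cases
      proof cases
        case 1
        then have "\<not> s" using no c(4) ex_side_iff[of C s] by auto
        moreover have "b1 = 0" using b0 1 b1_def by simp
        moreover have "w' = 0" using w(5) \<open>b1 = 0\<close> by simp
        ultimately show ?thesis using m1 1 by simp
      next
        case 2
        then have "s" using no c(5) ex_side_iff[of C s] by (cases s) auto
        moreover have "b2 = 0" using b0 2 b2_def by simp
        moreover have "w' = 0" using w(5) \<open>b2 = 0\<close> by simp
        ultimately show ?thesis using m2 2 by simp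
      next
        case 3
        then show ?thesis using m3[OF 3] rest[OF 3] no by simp
      qed
    qed
  qed
  have "m True c2 * m False c1 = (b2 + w') * (b1 + w') / (P * Q)"
    unfolding m1 m2 by (simp add: mult.commute)
  also have "\<dots> < (b1 + w) * (b2 + w) / (P * Q)"
  proof (intro divide_strict_right_mono)
    have "(b2 + w') * (b1 + w') \<le> (b2 + w) * (b1 + w')"
      using w b by (intro mult_right_mono) auto
    also have "\<dots> < (b2 + w) * (b1 + w)"
      using w b by (intro mult_strict_left_mono) auto
    finally show "(b2 + w') * (b1 + w') < (b1 + w) * (b2 + w)" by (simp add: mult.commute)
  qed (use pos in simp)
  also have "\<dots> = m True c1 * m False c2" unfolding m1 m2 by (simp add: mult.commute)
  finally show "m True c2 * m False c1 < m True c1 * m False c2" .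
qed

definition cross :: "('m + 'n) set \<Rightarrow> ('m + 'n) set \<Rightarrow> real^'n^'m \<Rightarrow> real" where
  "cross c1 c2 X = mass X True c1 * mass X False c2"

abbreviation \<sigma> :: real where
  "\<sigma> \<equiv> \<Sum>C\<in>comps. sqrt (b C)"

text \<open>Small enough that \<open>s\<close> components can each exceed \<open>\<surd>b\<^sub>C\<close> by this amount while the total stays
  below one.\<close>

definition slack :: real where
  "slack = (1 - \<sigma>) / (1 + real (card comps))"

lemma slack_pos: "\<sigma> < 1 \<Longrightarrow> 0 < slack"
  unfolding slack_def by simp

definition coord_box :: "('m + 'n) set \<Rightarrow> ('m + 'n) set \<Rightarrow> (('m + 'n) set \<Rightarrow> real) \<Rightarrow> bool" where
  "coord_box c1 c2 z \<longleftrightarrow>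
    (\<forall>C\<in>comps - {c1, c2}. sqrt (b C) < z C \<and> z C < sqrt (b C) + slack)"

text \<open>If the coordinate of a component lies slightly above \<open>\<surd>b\<^sub>C\<close>, the mass on the other side is at
  most \<open>\<surd>b\<^sub>C\<close>. So the other components use only a little more than \<open>\<surd>b\<^sub>C\<close> each, on both sides.\<close>

lemma coord_box_remainder:
  assumes sig: "\<sigma> < 1" and c: "c1 \<in> comps" "c2 \<in> comps" "c1 \<noteq> c2" and z: "coord_box c1 c2 z"
  shows "sqrt (b c1) + sqrt (b c2) < remainder c1 c2 z s"
proof -
  let ?O = "comps - {c1, c2}"
  have "spread z s C \<le> sqrt (b C) + slack" if C: "C \<in> ?O" for C
  proof (cases "s = has_row C")
    case True
    have "z C < sqrt (b C) + slack" using z C unfolding coord_box_def by blast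
    then show ?thesis using True by (simp add: spread_def)
  next
    case False
    have b: "0 \<le> b C" using C block_sum_nonneg by simp
    have zC: "sqrt (b C) < z C" using z C unfolding coord_box_def by simp
    then have "0 < z C" using b real_sqrt_ge_zero[OF b] by linarith
    have "b C = sqrt (b C) * sqrt (b C)" using b by simp
    also have "\<dots> \<le> sqrt (b C) * z C" using zC b by (intro mult_left_mono) auto
    finally have "b C / z C \<le> sqrt (b C)" using \<open>0 < z C\<close> by (simp add: field_simps)
    then show ?thesis using False slack_pos[OF sig] by (simp add: spread_def)
  qed
  then have "(\<Sum>C\<in>?O. spread z s C) \<le> (\<Sum>C\<in>?O. sqrt (b C) + slack)" by (rule sum_mono)
  also have "\<dots> = (\<Sum>C\<in>?O. sqrt (b C)) + real (card ?O) * slack" by (simp add: sum.distrib)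
  also have "real (card ?O) * slack \<le> real (card comps) * slack"
    using slack_pos[OF sig] finite_comps by (intro mult_right_mono of_nat_mono card_mono) auto
  also have "real (card comps) * slack < 1 - \<sigma>"
  proof -
    have "real (card comps) * slack < (1 + real (card comps)) * slack"
      using slack_pos[OF sig] by (intro mult_strict_right_mono) auto
    also have "\<dots> = 1 - \<sigma>" unfolding slack_def by simp
    finally show ?thesis .
  qed
  finally have "(\<Sum>C\<in>?O. spread z s C) < (\<Sum>C\<in>?O. sqrt (b C)) + (1 - \<sigma>)" by simp
  moreover have "\<sigma> = sqrt (b c1) + sqrt (b c2) + (\<Sum>C\<in>?O. sqrt (b C))"
    by (rule sum_comps_split[OF c])
  ultimately show ?thesis unfolding remainder_def by simp
qed

text \<open>Inside the box the masses left for \<open>c1\<close> and \<open>c2\<close> both exceed \<open>\<surd>b\<^sub>1 + \<surd>b\<^sub>2\<close>, so the larger and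
  the smaller root are real and distinct, and feasible masses result.\<close>

lemma coord_box_completion:
  assumes sig: "\<sigma> < 1"
    and c: "c1 \<in> comps" "c2 \<in> comps" "c1 \<noteq> c2" "has_row c1" "has_column c2"
    and z: "coord_box c1 c2 z"
  defines "X \<equiv> assemble (branch_masses c1 c2 z)"
  shows "X \<in> completions M" "\<And>C. C \<in> comps - {c1, c2} \<Longrightarrow> coord X C = z C"
    "cross c2 c1 X < cross c1 c2 X"
proof -
  have rem: "sqrt (b c1) + sqrt (b c2) < remainder c1 c2 z s" for s
    using coord_box_remainder[OF sig c(1-3) z] .
  have root: "0 \<le> sqrt (b C)" if "C \<in> comps" for C using block_sum_nonneg[OF that] by simp
  have rpos: "0 < remainder c1 c2 z s" for s
    using rem[of s] root[OF c(1)] root[OF c(2)] by linarith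
  have PQ: "(sqrt (b c1) + sqrt (b c2))\<^sup>2 < remainder c1 c2 z True * remainder c1 c2 z False"
    unfolding power2_eq_square using rem root[OF c(1)] root[OF c(2)]
    by (intro mult_strict_mono') auto
  have zC: "0 \<le> z C \<and> (0 < b C \<longrightarrow> 0 < z C)" if C: "C \<in> comps - {c1, c2}" for C
  proof -
    have "sqrt (b C) < z C" using z C unfolding coord_box_def by simp
    moreover have "0 \<le> sqrt (b C)" using root C by blast
    ultimately show ?thesis by linarith
  qed
  define m where "m = branch_masses c1 c2 z"
  have fe: "feasible m" "m True c2 * m False c1 < m True c1 * m False c2"
    unfolding m_def by (rule feasible_branch_masses[OF c zC rpos rpos PQ]; assumption)+
  have "X = assemble m" unfolding X_def m_def ..
  note as = feasible_assemble[OF fe(1), folded this]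
  show "X \<in> completions M" by (rule as)
  show "coord X C = z C" if C: "C \<in> comps - {c1, c2}" for C
  proof -
    have "C \<in> comps" "C \<noteq> c1" "C \<noteq> c2" using C by auto
    then show ?thesis
      using as(2)[of C "has_row C"] by (simp add: m_def coord_def branch_masses_def Let_def spread_def)
  qed
  show "cross c2 c1 X < cross c1 c2 X"
    using fe(2) unfolding cross_def using as(2)[OF c(1)] as(2)[OF c(2)] by simp
qed

text \<open>The other components have the same masses by \<open>mass_eq_spread\<close>, so \<open>c1\<close> and \<open>c2\<close> share the same
  remaining masses and \<open>two_block_masses_unique\<close> applies. The masses of \<open>c1\<close> and \<open>c2\<close> can degenerate
  only in the way allowed there, since a component with both a row and a column has positive mass
  on both sides.\<close>

lemma branch_unique:
  assumes c: "c1 \<in> comps" "c2 \<in> comps" "c1 \<noteq> c2" "has_row c1" "has_column c2"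
    and X: "X \<in> completions M" and Y: "Y \<in> completions M"
    and coord: "\<And>C. C \<in> comps - {c1, c2} \<Longrightarrow> coord X C = coord Y C"
    and br: "cross c2 c1 X \<le> cross c1 c2 X \<and> cross c2 c1 Y \<le> cross c1 c2 Y \<or>
      cross c1 c2 X \<le> cross c2 c1 X \<and> cross c1 c2 Y \<le> cross c2 c1 Y"
  shows "X = Y"
proof -
  have rest: "mass X s C = mass Y s C" if C: "C \<in> comps - {c1, c2}" for C s
    using C coord[OF C] mass_eq_spread[OF X, of C s] mass_eq_spread[OF Y, of C s]
    by (simp add: spread_def)
  have sums: "mass X s c1 + mass X s c2 = mass Y s c1 + mass Y s c2" for s
  proof -
    have "mass Z s c1 + mass Z s c2 = 1 - (\<Sum>C\<in>comps - {c1, c2}. mass Z s C)"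
      if "Z \<in> completions M" for Z
      using sum_mass[OF that, of s] unfolding sum_comps_split[OF c(1-3)] by linarith
    moreover have "(\<Sum>C\<in>comps - {c1, c2}. mass X s C) = (\<Sum>C\<in>comps - {c1, c2}. mass Y s C)"
      by (rule sum.cong[OF refl rest])
    ultimately show ?thesis using X Y by simp
  qed
  have degenerate: "mass Z (\<not> s) C = 0"
    if Z: "Z \<in> completions M" and C: "C \<in> comps" and s: "\<exists>v\<in>C. isl v = s" "mass Z s C = 0" for Z s C
  proof (rule mass_eq_0, rule notI)
    assume "\<exists>v\<in>C. isl v = (\<not> s)"
    then have "\<exists>v\<in>C. isl v = r" for r using s(1) by (cases "r = s") auto
    from mass_pos[OF Z C this, of s] show False using s(2) by simp
  qed
  have deg: "mass Z False c2 = 0 \<longrightarrow> mass Z True c2 = 0" "mass Z True c1 = 0 \<longrightarrow> mass Z False c1 = 0"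
    if Z: "Z \<in> completions M" for Z
    using degenerate[OF Z c(2), of False] degenerate[OF Z c(1), of True] c(4,5)
    unfolding ex_side_iff by auto
  have "mass X True c1 = mass Y True c1 \<and> mass X True c2 = mass Y True c2 \<and>
      mass X False c1 = mass Y False c1 \<and> mass X False c2 = mass Y False c2"
  proof (rule two_block_masses_unique)
    show "mass X True c1 * mass X False c1 = mass Y True c1 * mass Y False c1"
      "mass X True c2 * mass X False c2 = mass Y True c2 * mass Y False c2"
      using block_sum_eq_mass_product[OF X] block_sum_eq_mass_product[OF Y] c(1,2) by auto
    show "mass X True c2 * mass X False c1 \<le> mass X True c1 * mass X False c2 \<and>
        mass Y True c2 * mass Y False c1 \<le> mass Y True c1 * mass Y False c2 \<or>
        mass X True c1 * mass X False c2 \<le> mass X True c2 * mass X False c1 \<and>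
        mass Y True c1 * mass Y False c2 \<le> mass Y True c2 * mass Y False c1"
      using br unfolding cross_def .
  qed (intro sums mass_nonneg[OF X] mass_nonneg[OF Y] deg[OF X] deg[OF Y])+
  then have "mass X s C = mass Y s C" if "C \<in> comps" for C s
    using rest[of C s] that by (cases s; cases "C = c1"; cases "C = c2") auto
  then show ?thesis using completion_determined[OF X Y] by simp
qed

text \<open>If every row shared a component with every column, there would be just one component.\<close>

lemma separated_row_column:
  assumes "card comps \<ge> 2"
  obtains c1 c2 where "c1 \<in> comps" "c2 \<in> comps" "c1 \<noteq> c2" "has_row c1" "has_column c2"
proof -
  have "\<exists>i j. comp (Inl i) \<noteq> comp (Inr j)"
  proof (rule ccontr)
    assume "\<not> ?thesis"
    then have eq: "comp (Inl i) = comp (Inr j)" for i j by simp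
    have "comp v = comp (Inl undefined)" for v
    proof (cases v)
      case (Inl i)
      then show ?thesis using eq[of i undefined] eq[of undefined undefined] by simp
    next
      case (Inr j)
      then show ?thesis using eq[of undefined j] by simp
    qed
    then have "comps = {comp (Inl undefined)}" unfolding comps_eq by auto
    then show False using assms by simp
  qed
  then obtain i j where ij: "comp (Inl i) \<noteq> comp (Inr j)" by auto
  have "has_row (comp (Inl i))" "has_column (comp (Inr j))"
    unfolding has_row_def has_column_def using mem_comps_iff[OF comp_mem]
    by (auto intro: bexI[of _ "Inl i"] bexI[of _ "Inr j"])
  then show thesis using that ij comp_mem by blast
qed

section \<open>The tight case and the case of two components\<close>

text \<open>Cauchy-Schwarz: \<open>\<Sum>(\<surd>x\<^sub>C - \<surd>y\<^sub>C)\<^sup>2 = 2 - 2 \<sigma>\<close> vanishes.\<close>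

lemma unique_completion_if_tight:
  assumes sig: "\<sigma> = 1"
  shows "\<exists>!X. X \<in> completions M"
proof -
  have val: "mass X s C = sqrt (b C)" if X: "X \<in> completions M" and C: "C \<in> comps" for X s C
  proof -
    let ?x = "mass X True" and ?y = "mass X False"
    have nn: "0 \<le> mass X r D" for r D using mass_nonneg[OF X] .
    have "(\<Sum>D\<in>comps. (sqrt (?x D) - sqrt (?y D))\<^sup>2) =
        (\<Sum>D\<in>comps. ?x D + ?y D - 2 * sqrt (b D))"
      using nn block_sum_eq_mass_product[OF X]
      by (intro sum.cong refl) (simp add: power2_diff real_sqrt_mult)
    also have "\<dots> = (\<Sum>D\<in>comps. ?x D) + (\<Sum>D\<in>comps. ?y D) - 2 * \<sigma>"
      by (simp add: sum.distrib sum_subtractf sum_distrib_left)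
    also have "\<dots> = 0" using sum_mass[OF X] sig by simp
    finally have "(sqrt (?x C) - sqrt (?y C))\<^sup>2 = 0"
      using C finite_comps by (subst (asm) sum_nonneg_eq_0_iff) auto
    then have eq: "?x C = ?y C" by simp
    have "mass X s C = ?x C" using eq by (cases s) auto
    moreover have "b C = (?x C)\<^sup>2"
      using block_sum_eq_mass_product[OF X C] eq by (simp add: power2_eq_square)
    ultimately show ?thesis using nn by simp
  qed
  have "X = X0" if X: "X \<in> completions M" for X
    using val[OF X] val[OF X0] by (intro completion_determined[OF X X0]) simp
  then show ?thesis using X0 by auto
qed

lemma comps_pair:
  assumes "card comps = 2" "c1 \<in> comps" "c2 \<in> comps" "c1 \<noteq> c2"
  shows "comps = {c1, c2}"
  using assms finite_comps by (intro card_subset_eq[symmetric]) auto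

text \<open>The smaller cross product is zero: it has the column mass of \<open>c1\<close> and the row mass of \<open>c2\<close> as
  factors, and the isolated vertex lacks one of them. So every completion is on one branch.\<close>

lemma unique_completion_if_isolated:
  assumes s: "card comps = 2" and iso: "\<exists>C\<in>comps. isolated_vertex (dom M) C"
  shows "\<exists>!X. X \<in> completions M"
proof -
  obtain c1 c2 where c: "c1 \<in> comps" "c2 \<in> comps" "c1 \<noteq> c2" "has_row c1" "has_column c2"
    by (rule separated_row_column) (use s in auto)
  note pair = comps_pair[OF s c(1-3)]
  obtain C v where C: "C \<in> comps" "C = {v}" using iso unfolding isolated_vertex_def by auto
  have "\<not> has_column c1 \<or> \<not> has_row c2"
    using C c(4,5) pair unfolding has_row_def has_column_def by auto
  then have zero: "cross c2 c1 X = 0" for X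
    using mass_eq_0[of c1 False X] mass_eq_0[of c2 True X] unfolding cross_def ex_side_iff by auto
  have "0 \<le> cross c1 c2 X" if "X \<in> completions M" for X
    using mass_nonneg[OF that] unfolding cross_def by simp
  then have "X = X0" if X: "X \<in> completions M" for X
    using X0 X zero pair by (intro branch_unique[OF c X X0]) auto
  then show ?thesis using X0 by auto
qed

text \<open>Both components have rows and columns, so they can exchange roles, which exchanges the branches.\<close>

lemma two_completions_if_edges:
  assumes sig: "\<sigma> < 1" and s: "card comps = 2" and edges: "\<forall>C\<in>comps. has_edge (dom M) C"
  shows "card (completions M) = 2"
proof -
  obtain c1 c2 where c: "c1 \<in> comps" "c2 \<in> comps" "c1 \<noteq> c2"
    by (rule separated_row_column) (use s in auto)
  have sides: "has_row C" "has_column C" if "C \<in> comps" for C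
    using edges that unfolding has_edge_def positions_def has_row_def has_column_def by force+
  note pair = comps_pair[OF s c(1-3)]
  have box: "coord_box c1 c2 z" "coord_box c2 c1 z" for z
    using pair unfolding coord_box_def by auto
  obtain X where X: "X \<in> completions M" "cross c2 c1 X < cross c1 c2 X"
    using coord_box_completion[OF sig c sides(1)[OF c(1)] sides(2)[OF c(2)] box(1)] by blast
  obtain Y where Y: "Y \<in> completions M" "cross c1 c2 Y < cross c2 c1 Y"
    using coord_box_completion[OF sig c(2,1) c(3)[symmetric] sides(1)[OF c(2)] sides(2)[OF c(1)] box(2)]
    by blast
  have "Z = X \<or> Z = Y" if Z: "Z \<in> completions M" for Z
  proof (cases "cross c2 c1 Z \<le> cross c1 c2 Z")
    case True
    then have "Z = X" using X pair
      by (intro branch_unique[OF c sides(1)[OF c(1)] sides(2)[OF c(2)] Z X(1)]) auto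
    then show ?thesis ..
  next
    case False
    then have "Z = Y" using Y pair
      by (intro branch_unique[OF c sides(1)[OF c(1)] sides(2)[OF c(2)] Z Y(1)]) auto
    then show ?thesis ..
  qed
  then have "completions M = {X, Y}" using X Y by auto
  moreover have "X \<noteq> Y" using X Y by auto
  ultimately show ?thesis by simp
qed

section \<open>The dimension of the set of completions\<close>

lemma card_comps_le: "card comps \<le> CARD('m) + CARD('n)"
proof -
  have "card comps \<le> card (UNIV :: ('m + 'n) set)"
    unfolding comps_eq by (rule card_image_le) simp
  then show ?thesis by (simp add: UNIV_Plus_UNIV[symmetric] card_Plus del: UNIV_Plus_UNIV)
qed

text \<open>Ensures that the cubes of the expected dimension exist in the ambient space:
  \<open>m + n - 2 \<le> m n\<close>.\<close>

lemma card_comps_le_dimension: "card comps - 2 \<le> DIM(real^'n^'m)"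
proof -
  obtain p q where pq: "CARD('m) = Suc p" "CARD('n) = Suc q"
    by (metis zero_less_card_finite gr0_implies_Suc)
  have "card comps - 2 \<le> p + q" using card_comps_le pq by simp
  also have "\<dots> \<le> Suc p * Suc q" by simp
  finally show ?thesis using pq by simp
qed

lemma real_polynomial_mass [intro]: "real_polynomial_function (\<lambda>X::real^'n^'m. mass X s C)"
proof -
  have "real_polynomial_function (\<lambda>X::real^'n^'m. marginal X v)" for v
    unfolding marginal_def by (cases v) (auto intro!: real_polynomial_function_sum)
  then show ?thesis unfolding mass_def by (intro real_polynomial_function_sum) auto
qed

lemma real_polynomial_coord [intro]: "real_polynomial_function (\<lambda>X. coord X C)"
  unfolding coord_def by auto

lemma real_polynomial_cross [intro]: "real_polynomial_function (cross c1 c2)"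
  unfolding cross_def by auto

lemma basic_semialgebraic_completions: "basic_semialgebraic {X. X \<in> completions M}"
  unfolding completions_iff
  by (intro basic_semialgebraic_conj basic_semialgebraic_all basic_semialgebraic_ball
      basic_semialgebraic_eq basic_semialgebraic_le real_polynomial_function_sum
      real_polynomial_function.intros(2,4) real_polynomial_function_entry) auto

context
  fixes c1 c2 :: "('m + 'n) set" and B0 :: "(real^'n^'m) set" and axis_of :: "('m + 'n) set \<Rightarrow> real^'n^'m"
  assumes c: "c1 \<in> comps" "c2 \<in> comps" "c1 \<noteq> c2" "has_row c1" "has_column c2"
    and B0: "B0 \<subseteq> Basis" and axes: "bij_betw axis_of (comps - {c1, c2}) B0"
begin

lemma axis_inner:
  assumes "C \<in> comps - {c1, c2}" "D \<in> comps - {c1, c2}"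
  shows "axis_of C \<bullet> axis_of D = (if C = D then 1 else 0)"
proof -
  have "axis_of C \<in> Basis" "axis_of D \<in> Basis" using assms axes B0 bij_betwE by blast+
  moreover have "axis_of C = axis_of D \<longleftrightarrow> C = D"
    using assms axes by (meson bij_betw_def inj_on_eq_iff)
  ultimately show ?thesis by (simp add: inner_Basis)
qed

definition coord_vector :: "(('m + 'n) set \<Rightarrow> real) \<Rightarrow> real^'n^'m" where
  "coord_vector z = (\<Sum>C\<in>comps - {c1, c2}. z C *\<^sub>R axis_of C)"

lemma coord_vector_inner:
  assumes "C \<in> comps - {c1, c2}"
  shows "coord_vector z \<bullet> axis_of C = z C"
proof -
  have "coord_vector z \<bullet> axis_of C = (\<Sum>D\<in>comps - {c1, c2}. if D = C then z D else 0)"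
    unfolding coord_vector_def inner_sum_left
    using assms by (intro sum.cong refl) (simp add: axis_inner)
  then show ?thesis using assms finite_comps by simp
qed

lemma coord_vector_in_span: "coord_vector z \<in> span B0"
  unfolding coord_vector_def
  using axes by (intro span_sum span_scale span_base) (auto dest: bij_betwE)

lemma continuous_on_coord: "continuous_on S (\<lambda>X. coord X C)"
  by (intro continuous_on_polymonial_function) (auto simp flip: real_polynomial_function_eq)

lemma continuous_on_cross: "continuous_on S (cross c1' c2')"
  by (intro continuous_on_polymonial_function) (auto simp flip: real_polynomial_function_eq)

text \<open>The coordinates are injective on each branch. The part \<open>U\<close> of the cube that is mapped to the
  branch \<open>cross c1 c2 > cross c2 c1\<close> is open; if it is empty, the whole cube is mapped to the other branch.\<close>

lemma cube_dim_le:
  assumes B: "B \<subseteq> Basis" and A: "A' \<subseteq> completions M"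
    and hom: "homeomorphism (coordinate_cube B) A' f g"
  shows "card B \<le> card B0"
proof -
  let ?Q = "coordinate_cube B"
  define h where "h t = coord_vector (coord (f t))" for t
  have f: "continuous_on ?Q f" and inj: "inj_on f ?Q" and fK: "\<And>t. t \<in> ?Q \<Longrightarrow> f t \<in> completions M"
    using hom A unfolding homeomorphism_def by (auto intro: inj_on_inverseI)
  have h: "continuous_on ?Q h"
    unfolding h_def coord_vector_def
    by (intro continuous_intros continuous_on_compose2[OF continuous_on_coord[of UNIV] f]) auto
  have f_eq: "t = u" if tu: "t \<in> ?Q" "u \<in> ?Q" "h t = h u"
    and br: "cross c2 c1 (f t) \<le> cross c1 c2 (f t) \<and> cross c2 c1 (f u) \<le> cross c1 c2 (f u) \<or>
      cross c1 c2 (f t) \<le> cross c2 c1 (f t) \<and> cross c1 c2 (f u) \<le> cross c2 c1 (f u)" for t u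
  proof -
    have "coord (f t) C = coord (f u) C" if "C \<in> comps - {c1, c2}" for C
      using coord_vector_inner[OF that] tu(3) unfolding h_def by metis
    then have "f t = f u" by (intro branch_unique[OF c fK fK _ br] tu) auto
    then show ?thesis using inj tu by (meson inj_onD)
  qed
  define U where "U = {t \<in> ?Q. cross c2 c1 (f t) < cross c1 c2 (f t)}"
  have opU: "openin (top_of_set ?Q) U"
  proof -
    define d where "d t = cross c1 c2 (f t) - cross c2 c1 (f t)" for t
    have "continuous_on ?Q d"
      unfolding d_def
      by (intro continuous_intros continuous_on_compose2[OF continuous_on_cross[of UNIV] f]) auto
    then have "openin (top_of_set ?Q) (?Q \<inter> d -` {0<..})"
      by (rule continuous_openin_preimage_gen) simp
    moreover have "?Q \<inter> d -` {0<..} = U" unfolding U_def d_def by auto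
    ultimately show ?thesis by simp
  qed
  show ?thesis
  proof (cases "U = {}")
    case False
    show ?thesis
    proof (rule coordinate_cube_open_subset_dim_le[OF B B0 opU False])
      show "continuous_on U h" using h by (rule continuous_on_subset) (auto simp: U_def)
      show "inj_on h U" using f_eq unfolding U_def inj_on_def by auto
      show "h ` U \<subseteq> span B0" using coord_vector_in_span unfolding h_def by auto
    qed
  next
    case True
    then have low: "cross c1 c2 (f t) \<le> cross c2 c1 (f t)" if "t \<in> ?Q" for t
      using that unfolding U_def by force
    show ?thesis
    proof (rule coordinate_cube_open_subset_dim_le[OF B B0])
      show "openin (top_of_set ?Q) ?Q" by simp
      show "?Q \<noteq> {}" using coordinate_cube_nonempty[OF B] .
      show "inj_on h ?Q" using f_eq low unfolding inj_on_def by auto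
      show "h ` ?Q \<subseteq> span B0" using coord_vector_in_span unfolding h_def by auto
    qed (rule h)
  qed
qed

definition box_param :: "real^'n^'m \<Rightarrow> ('m + 'n) set \<Rightarrow> real" where
  "box_param t C = sqrt (b C) + slack * (t \<bullet> axis_of C)"

definition chart :: "real^'n^'m \<Rightarrow> real^'n^'m" where
  "chart t = assemble (branch_masses c1 c2 (box_param t))"

definition chart_image :: "(real^'n^'m) set" where
  "chart_image = {X. X \<in> completions M \<and> cross c2 c1 X < cross c1 c2 X \<and> coord_box c1 c2 (coord X)}"

definition chart_inverse :: "real^'n^'m \<Rightarrow> real^'n^'m" where
  "chart_inverse X = coord_vector (\<lambda>C. (coord X C - sqrt (b C)) / slack)"

lemma cube_iff:
  "t \<in> coordinate_cube B0 \<longleftrightarrow>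
    (\<forall>C\<in>comps - {c1, c2}. 0 < t \<bullet> axis_of C \<and> t \<bullet> axis_of C < 1) \<and> t \<in> span B0"
proof -
  have "B0 = axis_of ` (comps - {c1, c2})" using axes by (auto simp: bij_betw_def)
  then have "(\<forall>d\<in>B0. 0 < t \<bullet> d \<and> t \<bullet> d < 1) \<longleftrightarrow>
      (\<forall>C\<in>comps - {c1, c2}. 0 < t \<bullet> axis_of C \<and> t \<bullet> axis_of C < 1)" by simp
  then show ?thesis unfolding coordinate_cube_def span_substd_basis[OF B0] by auto
qed

lemma span_eqI:
  assumes "t \<in> span B0" "u \<in> span B0"
    and eq: "\<And>C. C \<in> comps - {c1, c2} \<Longrightarrow> t \<bullet> axis_of C = u \<bullet> axis_of C"
  shows "t = u"
proof (rule euclidean_eqI)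
  fix d :: "real^'n^'m" assume d: "d \<in> Basis"
  show "t \<bullet> d = u \<bullet> d"
  proof (cases "d \<in> B0")
    case True
    then obtain C where "C \<in> comps - {c1, c2}" "d = axis_of C"
      using axes unfolding bij_betw_def by blast
    then show ?thesis using eq by simp
  next
    case False
    then show ?thesis using assms(1,2) d unfolding span_substd_basis[OF B0] by auto
  qed
qed

context
  assumes sig: "\<sigma> < 1"
begin

lemma box_param_in_box: "t \<in> coordinate_cube B0 \<Longrightarrow> coord_box c1 c2 (box_param t)"
  using slack_pos[OF sig] unfolding cube_iff coord_box_def box_param_def by simp

lemma chart_in_image:
  assumes t: "t \<in> coordinate_cube B0"
  shows "chart t \<in> chart_image" "\<And>C. C \<in> comps - {c1, c2} \<Longrightarrow> coord (chart t) C = box_param t C"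
proof -
  note box = box_param_in_box[OF t]
  note cc = coord_box_completion[OF sig c box, folded chart_def]
  show *: "coord (chart t) C = box_param t C" if "C \<in> comps - {c1, c2}" for C
    using cc(2)[OF that] .
  have "coord_box c1 c2 (coord (chart t))"
    using box unfolding coord_box_def by (simp add: *)
  then show "chart t \<in> chart_image" unfolding chart_image_def using cc by simp
qed

lemma chart_inverse_chart:
  assumes t: "t \<in> coordinate_cube B0"
  shows "chart_inverse (chart t) = t"
proof (rule span_eqI)
  show "chart_inverse (chart t) \<in> span B0"
    unfolding chart_inverse_def by (rule coord_vector_in_span)
  show "t \<in> span B0" using t cube_iff by simp
  show "chart_inverse (chart t) \<bullet> axis_of C = t \<bullet> axis_of C" if C: "C \<in> comps - {c1, c2}" for C
    using slack_pos[OF sig] unfolding chart_inverse_def coord_vector_inner[OF C]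
      chart_in_image(2)[OF t C] box_param_def by simp
qed

lemma chart_chart_inverse:
  assumes X: "X \<in> chart_image"
  shows "chart_inverse X \<in> coordinate_cube B0" "chart (chart_inverse X) = X"
proof -
  show cube: "chart_inverse X \<in> coordinate_cube B0"
    unfolding cube_iff
  proof (intro conjI ballI)
    show "chart_inverse X \<in> span B0" unfolding chart_inverse_def by (rule coord_vector_in_span)
    fix C assume C: "C \<in> comps - {c1, c2}"
    have "sqrt (b C) < coord X C" "coord X C < sqrt (b C) + slack"
      using X C unfolding chart_image_def coord_box_def by blast+
    then show "0 < chart_inverse X \<bullet> axis_of C" "chart_inverse X \<bullet> axis_of C < 1"
      using slack_pos[OF sig] unfolding chart_inverse_def coord_vector_inner[OF C] by auto
  qed
  note ch = chart_in_image[OF cube]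
  show "chart (chart_inverse X) = X"
  proof (rule branch_unique[OF c])
    show "coord (chart (chart_inverse X)) C = coord X C" if C: "C \<in> comps - {c1, c2}" for C
      using slack_pos[OF sig] unfolding ch(2)[OF C] box_param_def
      by (simp add: chart_inverse_def coord_vector_inner[OF C])
  qed (use ch(1) X in \<open>auto simp: chart_image_def\<close>)
qed

text \<open>Both denominators \<open>P\<close> and \<open>Q\<close> and all coordinates stay positive on the cube.\<close>

lemma continuous_on_chart: "continuous_on (coordinate_cube B0) chart"
proof -
  let ?Q = "coordinate_cube B0"
  have root: "0 \<le> sqrt (b C)" if "C \<in> comps" for C using block_sum_nonneg[OF that] by simp
  have pos: "box_param t C \<noteq> 0" if t: "t \<in> ?Q" and C: "C \<in> comps - {c1, c2}" for t C
  proof -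
    have "sqrt (b C) < box_param t C" using box_param_in_box[OF t] C unfolding coord_box_def by blast
    then show ?thesis using root[of C] C by force
  qed
  have sp: "continuous_on ?Q (\<lambda>t. spread (box_param t) s C)" if C: "C \<in> comps - {c1, c2}" for s C
    unfolding spread_def using pos C
    by (cases "s = has_row C") (auto simp: box_param_def intro!: continuous_intros)
  have re: "continuous_on ?Q (\<lambda>t. remainder c1 c2 (box_param t) s)" for s
    unfolding remainder_def by (intro continuous_intros sp)
  have rpos: "remainder c1 c2 (box_param t) s \<noteq> 0" if "t \<in> ?Q" for t s
    using coord_box_remainder[OF sig c(1-3) box_param_in_box[OF that], of s] root[OF c(1)] root[OF c(2)]
    by linarith
  have br: "continuous_on ?Q (\<lambda>t. branch_masses c1 c2 (box_param t) s C)" if C: "C \<in> comps" for s C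
  proof -
    consider "C = c1" | "C \<noteq> c1" "C = c2" | "C \<noteq> c1" "C \<noteq> c2" by blast
    then show ?thesis
    proof cases
      case 1
      then show ?thesis unfolding branch_masses_def Let_def root_disc_def using rpos re
        by (cases s) (auto intro!: continuous_intros)
    next
      case 2
      then show ?thesis unfolding branch_masses_def Let_def root_disc_def using rpos re
        by (cases s) (auto intro!: continuous_intros)
    next
      case 3
      then show ?thesis unfolding branch_masses_def Let_def using sp[of C s] C by simp
    qed
  qed
  show ?thesis
    unfolding chart_def assemble_def
    by (intro continuous_intros continuous_on_vec_lambda br comp_mem)
qed

lemma continuous_on_chart_inverse: "continuous_on S chart_inverse"
  unfolding chart_inverse_def coord_vector_def
  using slack_pos[OF sig] by (intro continuous_intros continuous_on_coord) auto

lemma homeomorphism_chart: "homeomorphism (coordinate_cube B0) chart_image chart chart_inverse"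
proof (rule homeomorphismI)
  show "chart ` coordinate_cube B0 \<subseteq> chart_image" using chart_in_image(1) by blast
  show "chart_inverse ` chart_image \<subseteq> coordinate_cube B0" using chart_chart_inverse(1) by blast
qed (auto simp: continuous_on_chart continuous_on_chart_inverse chart_inverse_chart chart_chart_inverse)

text \<open>Since a completion on the branch \<open>cross c1 c2 > cross c2 c1\<close> is determined by its coordinates, the
  graph can be described without mentioning the formula for the chart, and the description is polynomial.\<close>

lemma chart_graph:
  "(\<lambda>t. (t, chart t)) ` coordinate_cube B0 =
    {p. fst p \<in> coordinate_cube B0 \<and> snd p \<in> completions M \<and>
      cross c2 c1 (snd p) < cross c1 c2 (snd p) \<and>
      (\<forall>C\<in>comps - {c1, c2}. coord (snd p) C = sqrt (b C) + slack * (fst p \<bullet> axis_of C))}"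
    (is "?L = ?R")
proof (intro equalityI subsetI)
  fix p assume "p \<in> ?L"
  then obtain t where t: "t \<in> coordinate_cube B0" "p = (t, chart t)" by blast
  then show "p \<in> ?R"
    using chart_in_image[OF t(1)] by (simp add: chart_image_def box_param_def)
next
  fix p assume p: "p \<in> ?R"
  obtain t X where tX: "p = (t, X)" by fastforce
  have t: "t \<in> coordinate_cube B0" using p tX by simp
  have "chart t = X"
    by (rule branch_unique[OF c])
      (use chart_in_image[OF t] p tX in \<open>auto simp: chart_image_def box_param_def\<close>)
  then show "p \<in> ?L" using t tX by blast
qed

lemma semialgebraic_chart_image: "semialgebraic chart_image"
  unfolding chart_image_def coord_box_def
  using finite_comps
  by (intro basic_semialgebraic_imp_semialgebraic basic_semialgebraic_conj
      basic_semialgebraic_completions basic_semialgebraic_ball basic_semialgebraic_less) auto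

lemma semialgebraic_chart_graph: "semialgebraic ((\<lambda>t. (t, chart t)) ` coordinate_cube B0)"
proof -
  have fst: "polynomial_function (fst :: (real^'n^'m) \<times> (real^'n^'m) \<Rightarrow> _)"
    and snd: "polynomial_function (snd :: (real^'n^'m) \<times> (real^'n^'m) \<Rightarrow> _)"
    by (simp_all add: polynomial_function_bounded_linear bounded_linear_fst bounded_linear_snd)
  have pf: "real_polynomial_function (\<lambda>p::(real^'n^'m) \<times> (real^'n^'m). q (fst p))"
    and ps: "real_polynomial_function (\<lambda>p::(real^'n^'m) \<times> (real^'n^'m). q (snd p))"
    if "real_polynomial_function q" for q
    using real_polynomial_function_compose[OF fst that] real_polynomial_function_compose[OF snd that]
    by (simp_all add: o_def)
  have cube: "basic_semialgebraic {t. t \<in> coordinate_cube B0}"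
    using basic_semialgebraic_coordinate_cube[OF B0] by simp
  show ?thesis
    unfolding chart_graph using finite_comps
    by (intro basic_semialgebraic_imp_semialgebraic basic_semialgebraic_conj
        basic_semialgebraic_vimage[OF fst cube]
        basic_semialgebraic_vimage[OF snd basic_semialgebraic_completions]
        basic_semialgebraic_ball basic_semialgebraic_less basic_semialgebraic_eq
        ps real_polynomial_cross real_polynomial_coord real_polynomial_function.intros(2-4)
        pf real_polynomial_function_inner) auto
qed

lemma cube_homeomorphic_chart_image:
  "semialgebraically_homeomorphic (coordinate_cube B0) chart_image"
  unfolding semialgebraically_homeomorphic_def
  using basic_semialgebraic_coordinate_cube[OF B0] basic_semialgebraic_imp_semialgebraic
    semialgebraic_chart_image homeomorphism_chart semialgebraic_chart_graph by blast

lemma semialgebraic_dim_completions: "semialgebraic_dim (completions M) = int (card B0)"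
proof -
  let ?D = "{card B | B :: (real^'n^'m) set. B \<subseteq> Basis \<and>
     (\<exists>A' \<subseteq> completions M. semialgebraically_homeomorphic (coordinate_cube B) A')}"
  have "Max ?D = card B0"
  proof (rule Max_eqI)
    have "?D \<subseteq> card ` Pow (Basis :: (real^'n^'m) set)" by auto
    then show "finite ?D" by (rule finite_subset) auto
    show "d \<le> card B0" if "d \<in> ?D" for d
      using that cube_dim_le unfolding semialgebraically_homeomorphic_def by blast
    have "chart_image \<subseteq> completions M" unfolding chart_image_def by auto
    then show "card B0 \<in> ?D" using B0 cube_homeomorphic_chart_image by blast
  qed
  then show ?thesis unfolding semialgebraic_dim_def using X0 by auto
qed

end

end

lemma dimension_if_slack:
  assumes sig: "\<sigma> < 1" and s: "card comps > 2"
  shows "semialgebraic_dim (completions M) = int (card comps) - 2"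
proof -
  obtain c1 c2 where c: "c1 \<in> comps" "c2 \<in> comps" "c1 \<noteq> c2" "has_row c1" "has_column c2"
    by (rule separated_row_column) (use s in auto)
  have card: "card (comps - {c1, c2}) = card comps - 2"
    using c finite_comps by (simp add: card_Diff_subset)
  obtain B0 where B0: "B0 \<subseteq> (Basis :: (real^'n^'m) set)" "card B0 = card (comps - {c1, c2})"
    using obtain_subset_with_card_n[of "card comps - 2" "Basis :: (real^'n^'m) set"]
      card_comps_le_dimension card by auto
  then obtain axis_of where "bij_betw axis_of (comps - {c1, c2}) B0"
    using finite_comps finite_subset[OF B0(1) finite_Basis] finite_same_card_bij[of "comps - {c1, c2}" B0]
    by auto
  from semialgebraic_dim_completions[OF c B0(1) this sig] show ?thesis using B0(2) card s by simp
qed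

end

theorem theorem3p1:
  fixes M Mbar :: "('n::finite, 'm::finite) partial_matrix"
  assumes "completable M"
    and "\<forall>v \<in> ran M. v > 0"
    and "cycle_completion M Mbar"
  shows
    "let \<C> = components_of_pattern (dom M);
         s = card \<C>;
         \<sigma> = (\<Sum>C\<in>\<C>. sqrt (block_sum Mbar C))
     in
       (\<sigma> = 1 \<longrightarrow> (\<exists>!X. X \<in> completions M)) \<and>
       (\<sigma> < 1 \<and> s = 2 \<and> (\<exists>C\<in>\<C>. isolated_vertex (dom M) C) \<longrightarrow> (\<exists>!X. X \<in> completions M)) \<and>
       (\<sigma> < 1 \<and> s = 2 \<and> (\<forall>C\<in>\<C>. has_edge (dom M) C) \<longrightarrow> card (completions M) = 2) \<and>
       (\<sigma> < 1 \<and> s > 2 \<longrightarrow>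
          basic_semialgebraic (completions M) \<and> semialgebraic_dim (completions M) = int s - 2)"
proof -
  obtain X0 where "X0 \<in> completions M" using assms(1) unfolding completable_def by blast
  then interpret completion_problem M Mbar X0
    using assms(2,3) by unfold_locales
  have "basic_semialgebraic (completions M)" using basic_semialgebraic_completions by simp
  then show ?thesis
    unfolding Let_def
    using unique_completion_if_tight unique_completion_if_isolated two_completions_if_edges
      dimension_if_slack by (intro conjI impI) (elim conjE, assumption | blast)+
qed

end
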